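(* Let $p$ be an odd prime, let $n\ge 3$, and let $L=\theta^n+a_{n-1}(t)\theta^{n-1}+\cdots+a_0(t)$ with $a_i(t)\in\mathbb{Z}_p[[t]]$, $a_i(0)=0$ for $i=0,\ldots,n-1$, $\theta=t\frac{d}{dt}$. Let $y_0,y_1,\ldots,y_{n-1}$ be the standard basis of solutions of $L(y)=0$, with associated power series $F_0,F_1,\ldots$, and suppose $\exp(F_1/F_0)\in\mathbb{Z}_p[[t]]$. Put $q=t\exp(F_1/F_0)$ and let $\sigma$ be the Frobenius lift determined by $q^\sigma=q^p$. Let $K(q)=\theta_q^2(y_2/y_0)$, where $\theta_q=q\frac{d}{dq}$, be the Yukawa coupling of $L$, and define $A_r$ ($r\ge1$) by the expansion $$K(q)=1+\sum_{r\ge1}\frac{A_rq^r}{1-q^r}.$$ Suppose that $L(y)=0$ has a $p$-adic Frobenius structure with $\alpha_1=0$. Then $A_r/r^2\in\mathbb{Z}_p$ for all $r\ge1$.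
   Context: Standard basis: since all $a_i(0)=0$ (MUM-type), $L(y)=0$ has a unique basis of solutions in $\mathbb{Q}_p[[t]][\log t]$ of the form $$y_i=F_0\frac{\log^i t}{i!}+F_1\frac{\log^{i-1}t}{(i-1)!}+\cdots+F_{i-1}\log t+F_i,\qquad i=0,\ldots,n-1,$$ with $F_i\in\mathbb{Q}_p[[t]]$, $F_0(0)=1$ and $F_i(0)=0$ for $i>0$. Solutions of $L(y)=0$ are the $\mathbb{Q}_p$-linear combinations of the $y_i$. Canonical coordinate: $q=t\exp(F_1/F_0)\in t+t^2\mathbb{Z}_p[[t]]$, so $\mathbb{Z}_p[[q]]=\mathbb{Z}_p[[t]]$ and $t$ is a power series in $q$. In terms of $q$ one has $y_1/y_0=\log q$ and $y_2/y_0=\frac12\log^2q+V(q)$ with $V=F_2/F_0-\frac12(F_1/F_0)^2\in q\mathbb{Q}_p[[q]]$, so $K(q)=1+\theta_q^2V\in1+q\mathbb{Q}_p[[q]]$. Frobenius lift: $\sigma$ is the ring endomorphism of $\mathbb{Z}_p[[t]]=\mathbb{Z}_p[[q]]$ given by $h(q)\mapsto h(q^p)$ (the "excellent lift"). It has the form $t^\sigma=t^p(1+p\,t\,u(t))$ with $u\in\mathbb{Z}_p[[t]]$. It is extended to solutions by $F_i^\sigma=F_i(t^\sigma)$ and $\log t^\sigma=p\log t-\sum_{m\ge1}\frac1m(-p\,t\,u(t))^m$; equivalently $\log q\mapsto p\log q$. One writes $y(t^\sigma)=y^\sigma$. Frobenius structure: $L(y)=0$ has a $p$-adic Frobenius structure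 (with respect to $\sigma$) if there is an operator $\mathcal{A}=\sum_{i=0}^{n-1}A_i(t)\theta^i\in\mathbb{Z}_p[[t]][\theta]$ with $A_0(0)=1$ such that for every solution $y(t)$ of $L(y)=0$ the composition $\mathcal{A}(y(t^\sigma))$ is again a solution of $L(y)=0$. The Frobenius constants are $\alpha_i=A_i(0)$. *)

theory Defs
  imports "HOL-Library.Cardinality" "HOL-Computational_Algebra.Computational_Algebra"
begin

section \<open>The \<open>p\<close>-adic integers and the \<open>p\<close>-adic numbers\<close>

text \<open>
  The prime is the cardinality of the index type \<open>'p :: prime_card\<close>.  A \<open>p\<close>-adic integer is a
  compatible sequence of residues in the inverse limit of the rings of integers modulo \<open>p^k\<close>,
  each residue being represented by its least nonnegative representative.
\<close>

class prime_card =
  assumes prime_card: "prime CARD('a)"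

lemma prime_card_int: "prime (int CARD('a::prime_card))"
  using prime_card by simp

typedef ('p::prime_card) padic_int =
  "{x :: nat \<Rightarrow> int. \<forall>k. x k = x (Suc k) mod int CARD('p) ^ k}"
  by (rule exI[of _ "\<lambda>_. 0"]) simp

setup_lifting type_definition_padic_int

lemma mod_power_Suc_mod: "(x mod (m::int) ^ Suc k) mod m ^ k = x mod m ^ k"
  by (rule mod_mod_cancel) (simp add: le_imp_power_dvd)

lemma padic_coherent_aux:
  assumes "\<forall>k. (x :: nat \<Rightarrow> int) k = x (Suc k) mod m ^ k"
  shows "x k mod m ^ k = x k" "x (Suc k) mod m ^ k = x k"
  using assms by (metis mod_mod_trivial)+

lemma padic_coherent_ops:
  fixes x y :: "nat \<Rightarrow> int"
  assumes "x k = x (Suc k) mod m ^ k" "y k = y (Suc k) mod m ^ k"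
  shows "(x k + y k) mod m ^ k = (x (Suc k) + y (Suc k)) mod m ^ Suc k mod m ^ k"
    and "(x k - y k) mod m ^ k = (x (Suc k) - y (Suc k)) mod m ^ Suc k mod m ^ k"
    and "(x k * y k) mod m ^ k = (x (Suc k) * y (Suc k)) mod m ^ Suc k mod m ^ k"
    and "(- x k) mod m ^ k = (- x (Suc k)) mod m ^ Suc k mod m ^ k"
  by (simp_all only: assms mod_power_Suc_mod mod_add_eq mod_diff_eq mod_mult_eq mod_minus_eq)

instantiation padic_int :: (prime_card) comm_ring_1
begin

lift_definition zero_padic_int :: "'a padic_int" is "\<lambda>_. 0" by simp

lift_definition one_padic_int :: "'a padic_int" is "\<lambda>k. 1 mod int CARD('a) ^ k"
  by (simp add: mod_power_Suc_mod del: power_Suc)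

lift_definition plus_padic_int :: "'a padic_int \<Rightarrow> 'a padic_int \<Rightarrow> 'a padic_int"
  is "\<lambda>x y k. (x k + y k) mod int CARD('a) ^ k"
  by (blast intro: padic_coherent_ops)

lift_definition minus_padic_int :: "'a padic_int \<Rightarrow> 'a padic_int \<Rightarrow> 'a padic_int"
  is "\<lambda>x y k. (x k - y k) mod int CARD('a) ^ k"
  by (blast intro: padic_coherent_ops)

lift_definition uminus_padic_int :: "'a padic_int \<Rightarrow> 'a padic_int"
  is "\<lambda>x k. (- x k) mod int CARD('a) ^ k"
  by (blast intro: padic_coherent_ops)

lift_definition times_padic_int :: "'a padic_int \<Rightarrow> 'a padic_int \<Rightarrow> 'a padic_int"
  is "\<lambda>x y k. (x k * y k) mod int CARD('a) ^ k"
  by (blast intro: padic_coherent_ops)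

instance
proof
  fix x y z :: "'a padic_int"
  show "x * y * z = x * (y * z)"
    by transfer (simp (no_asm) add: mod_simps mult.assoc)
  show "x * y = y * x"
    by transfer (simp (no_asm) add: mult.commute)
  show "1 * x = x"
    by transfer (rule ext, simp (no_asm) add: mod_simps, rule padic_coherent_aux(1), assumption)
  show "x + y + z = x + (y + z)"
    by transfer (simp (no_asm) add: mod_simps add.assoc)
  show "x + y = y + x"
    by transfer (simp (no_asm) add: add.commute)
  show "0 + x = x"
    by transfer (rule ext, simp (no_asm), rule padic_coherent_aux(1), assumption)
  show "- x + x = 0"
    by transfer (simp (no_asm) add: mod_simps)
  show "x - y = x + - y"
    by transfer (simp (no_asm) add: mod_simps)
  show "(x + y) * z = x * z + y * z"
    by transfer (simp (no_asm) add: mod_simps distrib_right)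
  show "(0 :: 'a padic_int) \<noteq> 1"
  proof transfer
    have "1 mod int CARD('a) ^ 1 = 1"
      using prime_gt_1_nat[OF prime_card[where 'a = 'a]] by simp
    then show "(\<lambda>_. 0) \<noteq> (\<lambda>k. 1 mod int CARD('a) ^ k)"
      by (metis zero_neq_one)
  qed
qed

end

lemma padic_coherent_mod:
  assumes "\<forall>k. (x :: nat \<Rightarrow> int) k = x (Suc k) mod m ^ k" and "j \<le> k"
  shows "x k mod m ^ j = x j"
  using assms(2)
proof (induction k rule: dec_induct)
  case base
  then show ?case using padic_coherent_aux[OF assms(1)] by simp
next
  case (step k)
  have "m ^ j dvd m ^ k" using step by (simp add: le_imp_power_dvd)
  then have "x (Suc k) mod m ^ j = (x (Suc k) mod m ^ k) mod m ^ j"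
    by (simp add: mod_mod_cancel)
  then show ?case using step padic_coherent_aux[OF assms(1)] by simp
qed

lemma prime_power_dvd_mult_cases:
  assumes "prime (q::int)" "q ^ (i + j) dvd a * b"
  shows "q ^ i dvd a \<or> q ^ j dvd b"
proof (cases "a = 0 \<or> b = 0")
  case False
  have nu: "\<not> is_unit q" using assms(1) not_prime_unit by blast
  have "i + j \<le> multiplicity q (a * b)"
    using assms False nu by (simp add: power_dvd_iff_le_multiplicity)
  also have "\<dots> = multiplicity q a + multiplicity q b"
    using assms(1) False by (intro prime_elem_multiplicity_mult_distrib) auto
  finally have "i \<le> multiplicity q a \<or> j \<le> multiplicity q b" by linarith
  then show ?thesis using multiplicity_dvd' by blast
qed auto

instance padic_int :: (prime_card) idom
proof
  fix x y :: "'a padic_int"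
  assume "x \<noteq> 0" "y \<noteq> 0"
  then show "x * y \<noteq> 0"
  proof transfer
    fix x y :: "nat \<Rightarrow> int"
    let ?p = "int CARD('a)"
    assume x: "\<forall>k. x k = x (Suc k) mod ?p ^ k" and y: "\<forall>k. y k = y (Suc k) mod ?p ^ k"
      and "x \<noteq> (\<lambda>_. 0)" "y \<noteq> (\<lambda>_. 0)"
    show "(\<lambda>k. x k * y k mod ?p ^ k) \<noteq> (\<lambda>_. 0)"
    proof
      assume z: "(\<lambda>k. x k * y k mod ?p ^ k) = (\<lambda>_. 0)"
      obtain i j where ij: "x i \<noteq> 0" "y j \<noteq> 0"
        using \<open>x \<noteq> (\<lambda>_. 0)\<close> \<open>y \<noteq> (\<lambda>_. 0)\<close> by (auto simp: fun_eq_iff)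
      have "?p ^ (i + j) dvd x (i + j) * y (i + j)"
        using fun_cong[OF z, of "i + j"] by (simp add: mod_eq_0_iff_dvd)
      then have "?p ^ i dvd x (i + j) \<or> ?p ^ j dvd y (i + j)"
        using prime_power_dvd_mult_cases[OF prime_card_int[where 'a = 'a]] by blast
      then show False
        using padic_coherent_mod[OF x, of i "i + j"] padic_coherent_mod[OF y, of j "i + j"] ij
        by (auto simp: dvd_eq_mod_eq_0)
    qed
  qed
qed

lemma Rep_padic_int_of_nat:
  "Rep_padic_int (of_nat m :: 'p::prime_card padic_int) k = int m mod int CARD('p) ^ k"
proof (induction m)
  case 0
  show ?case by (simp add: zero_padic_int.rep_eq)
next
  case (Suc m)
  then show ?case
    by (simp add: plus_padic_int.rep_eq one_padic_int.rep_eq mod_simps)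
qed

instance padic_int :: (prime_card) ring_char_0
proof
  have nz: "(of_nat m :: 'a padic_int) \<noteq> 0" if "m > 0" for m
  proof
    assume "(of_nat m :: 'a padic_int) = 0"
    then have "int m mod int CARD('a) ^ m = 0"
      by (metis Rep_padic_int_of_nat zero_padic_int.rep_eq)
    moreover have "m < CARD('a) ^ m"
      using prime_gt_1_nat[OF prime_card[where 'a = 'a]] by (simp add: power_gt_expt)
    then have "int m < int CARD('a) ^ m" by (metis of_nat_less_iff of_nat_power)
    ultimately show False using that by simp
  qed
  show "inj (of_nat :: nat \<Rightarrow> 'a padic_int)"
  proof (rule linorder_injI)
    fix i j :: nat assume "i < j"
    then obtain d where d: "j = i + d" "d > 0" using less_imp_add_positive by blast
    then show "of_nat i \<noteq> (of_nat j :: 'a padic_int)" using nz[OF d(2)] by simp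
  qed
qed

instance fract :: ("{idom,ring_char_0}") field_char_0
proof
  have "of_nat m = Fract (of_nat m :: 'a) 1" for m
    by (rule of_nat_fract)
  then show "inj (of_nat :: nat \<Rightarrow> 'a fract)"
    by (auto simp: inj_def eq_fract)
qed

type_synonym 'p padic = "'p padic_int fract"

definition Zp :: "'p::prime_card padic set"
  where "Zp = range (\<lambda>x. Fract x 1)"

definition Zp_fps :: "'p::prime_card padic fps set"
  where "Zp_fps = {f. \<forall>k. f $ k \<in> Zp}"


section \<open>Power series with logarithms\<close>

text \<open>
  The ring \<open>K[[t]][log t]\<close> is the polynomial ring over \<open>K[[t]]\<close>, with the polynomial variable
  in the role of \<open>log t\<close>; thus \<open>\<theta> = t d/dt\<close> is the derivation extending the one of \<open>K[[t]]\<close>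
  with \<open>\<theta> (log t) = 1\<close>.  After the change of variable \<open>in_q\<close> below, the same ring is read as
  \<open>K[[q]][log q]\<close>, and \<open>theta\<close> is then \<open>q d/dq\<close>.
\<close>

definition theta :: "'a::idom fps poly \<Rightarrow> 'a fps poly"
  where "theta y = map_poly fps_XD y + pderiv y"

text \<open>The operator \<open>c\<^sub>0 + c\<^sub>1 \<theta> + \<dots> + c\<^sub>n\<^sub>-\<^sub>1 \<theta>\<^sup>n\<^sup>-\<^sup>1\<close>.\<close>

definition theta_op :: "nat \<Rightarrow> (nat \<Rightarrow> 'a::idom fps) \<Rightarrow> 'a fps poly \<Rightarrow> 'a fps poly"
  where "theta_op n c y = (\<Sum>i<n. smult (c i) ((theta ^^ i) y))"

definition diff_op :: "nat \<Rightarrow> (nat \<Rightarrow> 'a::idom fps) \<Rightarrow> 'a fps poly \<Rightarrow> 'a fps poly"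
  where "diff_op n a y = (theta ^^ n) y + theta_op n a y"

definition log_sol :: "(nat \<Rightarrow> 'a::field_char_0 fps) \<Rightarrow> nat \<Rightarrow> 'a fps poly"
  where "log_sol F i = (\<Sum>j\<le>i. monom (fps_const (1 / fact (i - j)) * F j) (i - j))"

definition standard_basis ::
    "nat \<Rightarrow> (nat \<Rightarrow> 'a::field_char_0 fps) \<Rightarrow> (nat \<Rightarrow> 'a fps) \<Rightarrow> bool"
  where "standard_basis n a F \<longleftrightarrow>
    F 0 $ 0 = 1 \<and> (\<forall>i. 0 < i \<and> i < n \<longrightarrow> F i $ 0 = 0) \<and>
    (\<forall>i<n. diff_op n a (log_sol F i) = 0)"


section \<open>Canonical coordinate and Yukawa coupling\<close>

definition exp_ratio :: "(nat \<Rightarrow> 'a::field_char_0 fps) \<Rightarrow> 'a fps"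
  where "exp_ratio F = fps_exp 1 oo (F 1 / F 0)"

definition canonical_coord :: "(nat \<Rightarrow> 'a::field_char_0 fps) \<Rightarrow> 'a fps"
  where "canonical_coord F = fps_X * exp_ratio F"

text \<open>
  Rewriting an element of \<open>K[[t]][log t]\<close> as an element of \<open>K[[q]][log q]\<close>: substitute
  \<open>t = t(q)\<close>, the compositional inverse of \<open>q = q(t)\<close>, and \<open>log t = log q - (F\<^sub>1/F\<^sub>0)(t(q))\<close>.
\<close>

definition in_q :: "(nat \<Rightarrow> 'a::field_char_0 fps) \<Rightarrow> 'a fps poly \<Rightarrow> 'a fps poly"
  where "in_q F y =
    pcompose (map_poly (\<lambda>f. f oo fps_inv (canonical_coord F)) y)
      [: - ((F 1 / F 0) oo fps_inv (canonical_coord F)), 1 :]"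

text \<open>
  \<open>yukawa_log F\<close> is \<open>\<theta>\<^sub>q\<^sup>2 (y\<^sub>2/y\<^sub>0)\<close> in \<open>K[[q]][log q]\<close>; as \<open>y\<^sub>0 = F\<^sub>0\<close> is a unit of \<open>K[[t]]\<close>, the
  quotient is a scalar multiple of \<open>y\<^sub>2\<close>.  By \<open>yukawa_log_eq\<close> no logarithm survives, and
  \<open>yukawa F\<close> is this element as a power series in \<open>q\<close>.
\<close>

definition yukawa_log :: "(nat \<Rightarrow> 'a::field_char_0 fps) \<Rightarrow> 'a fps poly"
  where "yukawa_log F = (theta ^^ 2) (in_q F (smult (inverse (F 0)) (log_sol F 2)))"

definition yukawa :: "(nat \<Rightarrow> 'a::field_char_0 fps) \<Rightarrow> 'a fps"
  where "yukawa F = coeff (yukawa_log F) 0"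

lemma yukawa_log_eq:
  fixes F :: "nat \<Rightarrow> 'a::field_char_0 fps"
  assumes F0: "F 0 $ 0 = 1"
  defines "V \<equiv> (F 2 / F 0 - fps_const (1/2) * (F 1 / F 0)\<^sup>2) oo fps_inv (canonical_coord F)"
  shows "yukawa_log F = [: 1 + fps_XD (fps_XD V) :]" and "yukawa_log F = [: yukawa F :]"
proof -
  define T where "T = fps_inv (canonical_coord F)"
  define G where "G = (F 1 / F 0) oo T"
  define H where "H = (F 2 / F 0) oo T"
  have T0: "T $ 0 = 0" by (simp add: T_def fps_inv_def)
  have V: "V = H - fps_const (1/2) * G\<^sup>2"
    unfolding V_def G_def H_def T_def[symmetric]
    by (simp add: fps_compose_sub_distrib fps_compose_mult_distrib[OF T0] fps_compose_power[OF T0])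
  have inv: "F 0 * inverse (F 0) = 1" "\<And>f. inverse (F 0) * f = f / F 0"
    using F0 by (auto simp: inverse_mult_eq_1' fps_divide_unit mult.commute)
  have ls: "log_sol F 2 = [: F 2, F 1, fps_const (1/2) * F 0 :]"
    by (simp add: log_sol_def numeral_2_eq_2 monom_Suc monom_0 add.commute)
  have c: "inverse (F 0) * (fps_const (1/2) * F 0) = fps_const (1/2)"
    using inv(1) by (metis mult.assoc mult.commute mult.right_neutral)
  have half: "fps_const (1/2::'a) + fps_const (1/2) = 1"
    by (simp flip: fps_const_add fps_const_1_eq_1 add: fps_const_add)
  have "smult (inverse (F 0)) (log_sol F 2) = [: F 2 / F 0, F 1 / F 0, fps_const (1/2) :]"
    using c by (simp add: ls inv(2))
  then have "in_q F (smult (inverse (F 0)) (log_sol F 2)) =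
      pcompose [: H, G, fps_const (1/2) :] [: - G, 1 :]"
    by (simp add: in_q_def map_poly_pCons G_def H_def T_def)
  also have "\<dots> = [: H - G * G + fps_const (1/2) * (G * G),
      G - fps_const (1/2) * G - fps_const (1/2) * G, fps_const (1/2) :]"
    by (simp add: pcompose_pCons algebra_simps)
  also have "G - fps_const (1/2) * G - fps_const (1/2) * G = 0"
    using half by (metis diff_add_eq_diff_diff_swap diff_self distrib_right mult_1)
  also have "H - G * G + fps_const (1/2) * (G * G) = V"
  proof -
    have "G * G = fps_const (1/2) * (G * G) + fps_const (1/2) * (G * G)"
      using half by (metis distrib_right mult_1)
    then show ?thesis by (simp add: V power2_eq_square)
  qed
  finally have "yukawa_log F = theta (theta [: V, 0, fps_const (1/2) :])"
    by (simp add: yukawa_log_def numeral_2_eq_2)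
  also have "theta [: V, 0, fps_const (1/2) :] = [: fps_XD V, 1 :]"
    using half by (simp add: theta_def map_poly_pCons pderiv_pCons fps_XD_def)
  also have "theta \<dots> = [: 1 + fps_XD (fps_XD V) :]"
    by (simp add: theta_def map_poly_pCons pderiv_pCons fps_XD_def)
  finally show *: "yukawa_log F = [: 1 + fps_XD (fps_XD V) :]" .
  then show "yukawa_log F = [: yukawa F :]"
    by (simp add: yukawa_def)
qed


section \<open>Frobenius lift and Frobenius structure\<close>

text \<open>
  The endomorphism \<open>h(q) \<mapsto> h(q\<^sup>p)\<close>, in terms of \<open>t\<close>: \<open>Q = q(t)\<close> is the coordinate and
  \<open>h = f oo fps_inv Q\<close> is the expansion of \<open>f\<close> in powers of \<open>q\<close>.
\<close>

definition frob :: "nat \<Rightarrow> 'a::field_char_0 fps \<Rightarrow> 'a fps \<Rightarrow> 'a fps"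
  where "frob p Q f = (f oo fps_inv Q) oo (Q ^ p)"

text \<open>
  Extension to logarithms: \<open>log t\<close> goes to \<open>p log t + log (t\<^sup>\<sigma>/t\<^sup>p)\<close>.  Here \<open>t\<^sup>\<sigma>/t\<^sup>p\<close> has constant
  term 1, and \<open>fps_ln 1\<close> is the series of \<open>log (1 + x)\<close>; in the notation
  \<open>t\<^sup>\<sigma> = t\<^sup>p (1 + p t u)\<close> the second summand is the sum of \<open>- (- p t u)\<^sup>m/m\<close> over \<open>m \<ge> 1\<close>.
\<close>

definition frob_log :: "nat \<Rightarrow> 'a::field_char_0 fps \<Rightarrow> 'a fps poly \<Rightarrow> 'a fps poly"
  where "frob_log p Q y =
    pcompose (map_poly (frob p Q) y)
      [: fps_ln 1 oo (fps_shift p (frob p Q fps_X) - 1), of_nat p :]"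

definition frobenius_structure ::
    "nat \<Rightarrow> (nat \<Rightarrow> 'p::prime_card padic fps) \<Rightarrow> 'p padic fps \<Rightarrow> (nat \<Rightarrow> 'p padic fps) \<Rightarrow> bool"
  where "frobenius_structure n a Q A \<longleftrightarrow>
    (\<forall>i<n. A i \<in> Zp_fps) \<and> A 0 $ 0 = 1 \<and>
    (\<forall>y. diff_op n a y = 0 \<longrightarrow> diff_op n a (theta_op n A (frob_log CARD('p) Q y)) = 0)"

definition frobenius_constant :: "(nat \<Rightarrow> 'a::zero fps) \<Rightarrow> nat \<Rightarrow> 'a"
  where "frobenius_constant A i = A i $ 0"

end

theory Submission
  imports Defs
begin

text \<open>
  Write \<open>\<A>\<close> for the Frobenius structure.  As \<open>L\<close> reduces to \<open>\<theta>\<^sup>n\<close> at \<open>t = 0\<close>, a solution is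
  determined by its constant terms, that is, by its value at \<open>t = 0\<close> as a polynomial in \<open>log t\<close>
  (\<open>solution_eq_0\<close>).  Comparing constant terms and using \<open>\<alpha>\<^sub>1 = 0\<close>, one finds
  \<open>\<A>(y\<^sub>0\<^sup>\<sigma>) = y\<^sub>0\<close>, \<open>\<A>(y\<^sub>1\<^sup>\<sigma>) = p y\<^sub>1\<close> and \<open>\<A>(y\<^sub>2\<^sup>\<sigma>) = p\<^sup>2 (y\<^sub>2 + \<alpha>\<^sub>2 y\<^sub>0)\<close>.

  The first equation is a functional equation for \<open>F\<^sub>0\<close>.  Because \<open>t\<^sup>\<sigma>\<close> has order \<open>p\<close>, it computes
  each coefficient of \<open>F\<^sub>0\<close> from earlier ones, so \<open>F\<^sub>0\<close> is integral (\<open>F0_series\<close>).  Now divide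
  by \<open>y\<^sub>0\<close> and pass to the coordinate \<open>q\<close>: the operator \<open>F\<^sub>0\<^sup>-\<^sup>1 \<A> F\<^sub>0\<^sup>\<sigma> = \<Sum> b\<^sub>j \<theta>\<^sub>q\<^sup>j\<close> has integral
  coefficients (\<open>theta_op_in_operators\<close>), and it fixes \<open>1\<close> and \<open>p log q\<close>, so \<open>b\<^sub>0 = 1\<close> and
  \<open>b\<^sub>1 = 0\<close>.  Its action on \<open>(y\<^sub>2/y\<^sub>0)\<^sup>\<sigma> = p\<^sup>2 log\<^sup>2 q/2 + V(q\<^sup>p)\<close> gives, after division by
  \<open>p\<^sup>2\<close>,
    \<open>V(q) + \<alpha>\<^sub>2 - p\<^sup>-\<^sup>2 V(q\<^sup>p) = b\<^sub>2 + \<Sum>\<^sub>j\<^sub>\<ge>\<^sub>2 p\<^sup>j\<^sup>-\<^sup>2 b\<^sub>j (\<theta>\<^sub>q\<^sup>j V)(q\<^sup>p)\<close>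
  (\<open>frobenius_relation_q\<close>).  The right-hand side involves \<open>V\<close> only through \<open>\<theta>\<^sub>q\<^sup>2 V = K - 1\<close>,
  evaluated at \<open>q\<^sup>p\<close>.  Applying \<open>\<theta>\<^sub>q\<^sup>2\<close> therefore gives a recursion showing that \<open>K\<close> is integral; then the
  right-hand side is integral, and so are the non-constant coefficients of
  \<open>V(q) - p\<^sup>-\<^sup>2 V(q\<^sup>p)\<close> (\<open>frobenius_integrality\<close>).

  If \<open>v\<^sub>m\<close> are the coefficients of \<open>V\<close>, then \<open>m\<^sup>2 v\<^sub>m\<close> is the sum of the \<open>A\<^sub>r\<close> with \<open>r\<close> dividing
  \<open>m\<close>, and integrality of \<open>v\<^sub>m - p\<^sup>-\<^sup>2 v\<^sub>m\<^sub>/\<^sub>p\<close> for all \<open>m\<close> yields \<open>A\<^sub>m \<in> m\<^sup>2 \<int>\<^sub>p\<close> by induction over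
  divisors (\<open>lambert_coefficients_integral\<close>).
\<close>

section \<open>Power series with coefficients in a subring\<close>

locale coeff_subring =
  fixes R :: "'a::field_char_0 set"
  assumes one_closed: "1 \<in> R"
    and diff_closed: "x \<in> R \<Longrightarrow> y \<in> R \<Longrightarrow> x - y \<in> R"
    and mult_closed: "x \<in> R \<Longrightarrow> y \<in> R \<Longrightarrow> x * y \<in> R"
begin

lemma zero_closed: "0 \<in> R"
  using diff_closed[OF one_closed one_closed] by simp

lemma add_closed: "x \<in> R \<Longrightarrow> y \<in> R \<Longrightarrow> x + y \<in> R"
  using diff_closed[of x "0 - y"] diff_closed[of 0 y] zero_closed by simp

lemma of_nat_closed: "of_nat k \<in> R"
  by (induction k) (auto intro: add_closed one_closed zero_closed)

lemma sum_closed: "(\<And>i. i \<in> I \<Longrightarrow> f i \<in> R) \<Longrightarrow> sum f I \<in> R"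
  by (induction I rule: infinite_finite_induct) (auto intro: add_closed zero_closed)

definition series :: "'a fps set"
  where "series = {f. \<forall>k. f $ k \<in> R}"

text \<open>
  Integrality of a solution and of the Yukawa coupling is proved one coefficient at a time, so the
  closure properties are needed for truncations too.
\<close>

definition series_upto :: "nat \<Rightarrow> 'a fps set"
  where "series_upto m = {f. \<forall>k\<le>m. f $ k \<in> R}"

lemma series_iff_upto: "f \<in> series \<longleftrightarrow> (\<forall>m. f \<in> series_upto m)"
  by (auto simp: series_def series_upto_def)

lemma series_upto_add: "f \<in> series_upto m \<Longrightarrow> g \<in> series_upto m \<Longrightarrow> f + g \<in> series_upto m"
  by (auto simp: series_upto_def intro: add_closed)

lemma series_upto_mult: "f \<in> series_upto m \<Longrightarrow> g \<in> series_upto m \<Longrightarrow> f * g \<in> series_upto m"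
  by (auto simp: series_upto_def fps_mult_nth intro!: sum_closed mult_closed)

lemma series_upto_zero: "0 \<in> series_upto m"
  by (auto simp: series_upto_def zero_closed)

lemma series_upto_one: "1 \<in> series_upto m"
  by (auto simp: series_upto_def zero_closed one_closed)

lemma series_upto_sum: "(\<And>i. i \<in> I \<Longrightarrow> f i \<in> series_upto m) \<Longrightarrow> sum f I \<in> series_upto m"
  by (induction I rule: infinite_finite_induct) (auto intro: series_upto_add series_upto_zero)

lemma series_upto_XD: "f \<in> series_upto m \<Longrightarrow> fps_XD f \<in> series_upto m"
  by (auto simp: series_upto_def intro: mult_closed of_nat_closed)

lemma series_upto_XDs: "f \<in> series_upto m \<Longrightarrow> (fps_XD ^^ i) f \<in> series_upto m"
  by (induction i) (auto intro: series_upto_XD)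

lemma series_add: "f \<in> series \<Longrightarrow> g \<in> series \<Longrightarrow> f + g \<in> series"
  and series_mult: "f \<in> series \<Longrightarrow> g \<in> series \<Longrightarrow> f * g \<in> series"
  and series_zero: "0 \<in> series"
  and series_one: "1 \<in> series"
  and series_XD: "f \<in> series \<Longrightarrow> fps_XD f \<in> series"
  by (simp_all add: series_iff_upto series_upto_add series_upto_mult series_upto_zero
      series_upto_one series_upto_XD)

lemma series_X: "fps_X \<in> series"
  by (auto simp: series_def fps_X_def zero_closed one_closed)

lemma series_power: "f \<in> series \<Longrightarrow> f ^ i \<in> series"
  by (induction i) (auto intro: series_one series_mult)

lemma series_compose: "f \<in> series \<Longrightarrow> g \<in> series \<Longrightarrow> f oo g \<in> series"
  using series_power[of g]
  by (auto simp: series_def fps_compose_nth intro!: sum_closed mult_closed)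

lemma series_inverse:
  assumes f: "f \<in> series" and f0: "f $ 0 = 1"
  shows "inverse f \<in> series"
proof -
  have "inverse f $ n \<in> R" for n
  proof (induction n rule: less_induct)
    case (less n)
    have "(\<Sum>i=0..n. f $ i * inverse f $ (n - i)) = (1 :: 'a fps) $ n"
      using inverse_mult_eq_1'[of f] f0 by (metis fps_mult_nth zero_neq_one)
    then have "inverse f $ n = (1 :: 'a fps) $ n - (\<Sum>i=1..n. f $ i * inverse f $ (n - i))"
      by (simp add: sum.atLeast_Suc_atMost[of 0 n] f0 algebra_simps)
    also have "\<dots> \<in> R"
    proof (intro diff_closed sum_closed mult_closed)
      show "(1 :: 'a fps) $ n \<in> R" using series_one by (auto simp: series_def)
      show "f $ i \<in> R" for i using f by (auto simp: series_def)
      show "inverse f $ (n - i) \<in> R" if "i \<in> {1..n}" for i using less that by auto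
    qed
    finally show ?case .
  qed
  then show ?thesis by (auto simp: series_def)
qed

text \<open>
  Comparing the coefficients of \<open>x\<^sup>n\<close> in \<open>f\<^sup>-\<^sup>1(f(x)) = x\<close> expresses the \<open>n\<close>-th coefficient of
  \<open>f\<^sup>-\<^sup>1\<close> through the earlier ones without any division, since \<open>f\<^sup>n\<close> has leading coefficient \<open>1\<close>.
\<close>

lemma series_compositional_inverse:
  assumes f: "f \<in> series" and f0: "f $ 0 = 0" and f1: "f $ 1 = 1"
  shows "fps_inv f \<in> series"
proof -
  have "fps_inv f $ n \<in> R" for n
  proof (induction n rule: less_induct)
    case (less n)
    have lead: "f ^ n $ n = 1" using f0 f1 by (simp add: startsby_zero_power_nth_same)
    have "(\<Sum>i=0..n. fps_inv f $ i * f ^ i $ n) = fps_X $ n"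
      using fps_inv[of f] f0 f1 by (metis fps_compose_nth zero_neq_one)
    then have "fps_inv f $ n = fps_X $ n - (\<Sum>i\<in>{0..<n}. fps_inv f $ i * f ^ i $ n)"
      using lead by (simp add: sum.last_plus algebra_simps)
    also have "\<dots> \<in> R"
    proof (intro diff_closed sum_closed mult_closed)
      show "fps_X $ n \<in> R" using series_X by (auto simp: series_def)
      show "f ^ i $ n \<in> R" for i using series_power[OF f] by (auto simp: series_def)
      show "fps_inv f $ i \<in> R" if "i \<in> {0..<n}" for i using less that by auto
    qed
    finally show ?case .
  qed
  then show ?thesis by (auto simp: series_def)
qed

text \<open>
  Substituting a series of order at least two lowers the number of coefficients that matter: the
  coefficients of \<open>f(g)\<close> up to \<open>m\<close> only involve those of \<open>f\<close> up to \<open>m/2\<close>.  A Frobenius lift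
  \<open>t \<mapsto> t\<^sup>p + \<dots>\<close> is such a substitution, and this makes functional equations that express \<open>f\<close> through
  \<open>f\<^sup>\<sigma>\<close> into recursions for the coefficients of \<open>f\<close>.
\<close>

lemma series_upto_compose_contracting:
  assumes f: "\<And>k. k < m \<Longrightarrow> f $ k \<in> R" and "m > 0"
    and g: "g \<in> series" and g0: "g $ 0 = 0" and g1: "g $ 1 = 0"
  shows "f oo g \<in> series_upto m"
proof -
  have "f $ i * g ^ i $ k \<in> R" if "k \<le> m" for i k
  proof (cases "i < m")
    case True
    then show ?thesis using f series_power[OF g, of i] by (auto simp: series_def intro: mult_closed)
  next
    case False
    have "g ^ i $ k = 0"
    proof (cases "g = 0")
      case True
      then show ?thesis using False \<open>m > 0\<close> by (simp add: power_0_left)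
    next
      case nz: False
      then have "2 \<le> subdegree g"
      proof (intro subdegree_geI)
        fix j :: nat assume "j < 2"
        then have "j = 0 \<or> j = 1" by auto
        then show "g $ j = 0" using g0 g1 by blast
      qed auto
      then have "i * 2 \<le> i * subdegree g" by (rule mult_le_mono2)
      moreover have "k < i * 2" using that False \<open>m > 0\<close> by linarith
      ultimately have "k < subdegree (g ^ i)" by (simp only: subdegree_power)
      then show ?thesis by (rule nth_less_subdegree_zero)
    qed
    then show ?thesis using zero_closed by simp
  qed
  then show ?thesis by (auto simp: series_upto_def fps_compose_nth intro: sum_closed)
qed

end


section \<open>The ring of \<open>p\<close>-adic integers inside its field of fractions\<close>

lemma Zp_subring: "coeff_subring (Zp :: 'p::prime_card padic set)"
proof
  have i: "Fract x 1 \<in> Zp" for x :: "'p padic_int" by (auto simp: Zp_def)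
  show "(1 :: 'p padic) \<in> Zp" using i[of 1] by (simp add: One_fract_def)
  fix x y :: "'p padic" assume "x \<in> Zp" "y \<in> Zp"
  then obtain a b where "x = Fract a 1" "y = Fract b 1" by (auto simp: Zp_def)
  then show "x - y \<in> Zp" "x * y \<in> Zp" using i by simp_all
qed

interpretation Zp: coeff_subring Zp
  by (rule Zp_subring)

lemma Zp_series [simp]: "Zp.series = Zp_fps"
  by (simp add: Zp.series_def Zp_fps_def)

text \<open>
  The residues modulo \<open>p\<^sup>k\<close> of the inverse are the inverses modulo \<open>p\<^sup>k\<close>; they are compatible
  because inverses modulo \<open>p\<^sup>k\<close> are unique.
\<close>

lemma inverse_of_nat_in_Zp:
  assumes s: "\<not> CARD('p::prime_card) dvd s"
  shows "1 / of_nat s \<in> (Zp :: 'p padic set)"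
proof -
  define P where "P = int CARD('p)"
  have cop: "coprime (int s) (P ^ k)" for k
  proof -
    have "coprime (CARD('p)) s" using s prime_card[where 'a = 'p] prime_imp_coprime by blast
    then show ?thesis unfolding P_def by (simp add: coprime_commute)
  qed
  have "\<exists>y. int s * y mod P ^ k = 1 mod P ^ k" for k
  proof -
    obtain u v where "u * int s + v * P ^ k = 1"
      using bezout_int[of "int s" "P ^ k"] cop[of k] by (auto simp: coprime_iff_gcd_eq_1)
    then have "int s * u = 1 + P ^ k * (- v)" by (simp add: algebra_simps)
    then show ?thesis by (metis mod_mult_self2)
  qed
  then obtain y where y: "int s * y k mod P ^ k = 1 mod P ^ k" for k by metis
  define z where "z k = y k mod P ^ k" for k
  have coh: "\<forall>k. z k = z (Suc k) mod P ^ k"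
  proof
    fix k
    have "int s * y (Suc k) mod P ^ k = int s * y k mod P ^ k"
      using y[of "Suc k"] y[of k] by (metis mod_power_Suc_mod)
    then have "P ^ k dvd int s * (y (Suc k) - y k)"
      by (simp add: mod_eq_dvd_iff right_diff_distrib)
    then have "P ^ k dvd y (Suc k) - y k"
      using cop[of k] by (simp add: coprime_dvd_mult_right_iff coprime_commute)
    then show "z k = z (Suc k) mod P ^ k"
      unfolding z_def mod_power_Suc_mod by (metis mod_eq_dvd_iff)
  qed
  define x where "x = (Abs_padic_int z :: 'p padic_int)"
  have rep: "Rep_padic_int x = z"
    unfolding x_def
    by (rule Abs_padic_int_inverse, unfold mem_Collect_eq P_def[symmetric], rule coh)
  have "of_nat s * x = 1"
  proof (rule Rep_padic_int_inject[THEN iffD1], rule ext)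
    fix k
    have "Rep_padic_int (of_nat s * x) k = int s * y k mod P ^ k"
      by (simp add: times_padic_int.rep_eq rep Rep_padic_int_of_nat z_def P_def mod_simps)
    also have "\<dots> = Rep_padic_int (1 :: 'p padic_int) k"
      using y by (simp add: one_padic_int.rep_eq P_def)
    finally show "Rep_padic_int (of_nat s * x) k = Rep_padic_int (1 :: 'p padic_int) k" .
  qed
  then have "of_nat s * Fract x 1 = (1 :: 'p padic)"
    by (simp add: of_nat_fract One_fract_def)
  moreover have "of_nat s \<noteq> (0 :: 'p padic)" using s by (metis dvd_0_right of_nat_eq_0_iff)
  ultimately have "1 / of_nat s = Fract x 1" by (simp add: field_simps)
  then show ?thesis by (auto simp: Zp_def)
qed


section \<open>Solutions with logarithms\<close>

lemma coeff_theta: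
  "coeff (theta y) j = fps_XD (coeff y j) + of_nat (Suc j) * coeff y (Suc j)"
  by (simp add: theta_def coeff_map_poly coeff_pderiv fps_XD_def)

lemma theta_add: "theta (y + z) = theta y + theta z"
  by (rule poly_eqI) (simp add: coeff_theta algebra_simps fps_XD_def)

lemma theta_smult: "theta (smult f y) = smult (fps_XD f) y + smult f (theta y)"
  by (rule poly_eqI) (simp add: coeff_theta algebra_simps fps_XD_def)

lemma theta_0 [simp]: "theta 0 = 0"
  by (simp add: theta_def)

lemma theta_sum: "theta (sum f I) = (\<Sum>i\<in>I. theta (f i))"
  by (induction I rule: infinite_finite_induct) (simp_all add: theta_add)

lemma smult_sum_right: "smult f (sum g I) = (\<Sum>i\<in>I. smult f (g i))"
  by (induction I rule: infinite_finite_induct) (simp_all add: smult_add_right)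

lemma theta_smult_const: "theta (smult (fps_const c) y) = smult (fps_const c) (theta y)"
  by (simp add: theta_smult fps_XD_def)

lemma theta_pow_add: "(theta ^^ i) (y + z) = (theta ^^ i) y + (theta ^^ i) z"
  by (induction i) (simp_all add: theta_add)

lemma theta_pow_smult_const:
  "(theta ^^ i) (smult (fps_const c) y) = smult (fps_const c) ((theta ^^ i) y)"
  by (induction i) (simp_all add: theta_smult_const)

lemma diff_op_add: "diff_op n a (y + z) = diff_op n a y + diff_op n a z"
  by (simp add: diff_op_def theta_op_def theta_pow_add smult_add_right sum.distrib)

lemma diff_op_smult_const: "diff_op n a (smult (fps_const c) y) = smult (fps_const c) (diff_op n a y)"
  by (simp add: diff_op_def theta_op_def theta_pow_smult_const smult_add_right smult_sum_right
      mult.commute)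

text \<open>
  The coefficient of \<open>t\<^sup>m\<close> of an element of \<open>K[[t]][log t]\<close>, a polynomial in \<open>log t\<close>.  On this
  slice \<open>\<theta>\<close> acts as \<open>m + d/d log t\<close>.
\<close>

definition slice :: "nat \<Rightarrow> 'a::idom fps poly \<Rightarrow> 'a poly"
  where "slice m y = map_poly (\<lambda>f. f $ m) y"

lemma coeff_slice: "coeff (slice m y) j = coeff y j $ m"
  by (simp add: slice_def coeff_map_poly)

lemma slice_0 [simp]: "slice m 0 = 0"
  by (simp add: slice_def)

lemma slice_add: "slice m (y + z) = slice m y + slice m z"
  by (rule poly_eqI) (simp add: coeff_slice)

lemma slice_sum: "slice m (sum f I) = (\<Sum>i\<in>I. slice m (f i))"
  by (induction I rule: infinite_finite_induct) (simp_all add: slice_add)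

lemma slice_theta: "slice m (theta y) = smult (of_nat m) (slice m y) + pderiv (slice m y)"
  by (rule poly_eqI) (simp add: coeff_slice coeff_theta coeff_pderiv fps_of_nat[symmetric])

lemma slice_0_smult: "slice 0 (smult f y) = smult (f $ 0) (slice 0 y)"
  by (rule poly_eqI) (simp add: coeff_slice)

lemma slice_0_theta_op:
  "slice 0 (theta_op n A y) = (\<Sum>i<n. smult (A i $ 0) ((pderiv ^^ i) (slice 0 y)))"
proof -
  have "slice 0 ((theta ^^ i) y) = (pderiv ^^ i) (slice 0 y)" for i
    by (induction i) (simp_all add: slice_theta)
  then show ?thesis by (simp add: theta_op_def slice_sum slice_0_smult)
qed

lemma mult_plus_pderiv_inj:
  fixes c :: "'a::field_char_0 poly"
  assumes "smult (of_nat m) c + pderiv c = 0" and "m > 0"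
  shows "c = 0"
proof -
  have "coeff (smult (of_nat m) c + pderiv c) (degree c) = of_nat m * lead_coeff c"
    by (simp add: coeff_pderiv coeff_eq_0)
  then show ?thesis using assms by simp
qed

text \<open>
  Since \<open>L\<close> reduces to \<open>\<theta>\<^sup>n\<close> at \<open>t = 0\<close>, the lowest slice \<open>t\<^sup>m c(log t)\<close> of a solution satisfies
  \<open>(m + d/d log t)\<^sup>n c = 0\<close>, and \<open>m + d/d log t\<close> is injective on polynomials for \<open>m > 0\<close>.
\<close>

lemma solution_eq_0:
  fixes a :: "nat \<Rightarrow> 'a::field_char_0 fps"
  assumes a: "\<And>i. i < n \<Longrightarrow> a i $ 0 = 0" and y: "diff_op n a y = 0" and y0: "slice 0 y = 0"
  shows "y = 0"
proof -
  have "slice m y = 0" for m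
  proof (induction m rule: less_induct)
    case (less m)
    show ?case
    proof (cases "m = 0")
      case True
      then show ?thesis using y0 by simp
    next
      case False
      define N where "N c = smult (of_nat m) c + pderiv c" for c :: "'a poly"
      have lower: "slice k ((theta ^^ i) y) = 0" if "k < m" for k i
        using less that by (induction i) (simp_all add: slice_theta)
      have pow: "slice m ((theta ^^ i) y) = (N ^^ i) (slice m y)" for i
        by (induction i) (simp_all add: slice_theta N_def)
      have "slice m (smult (a i) ((theta ^^ i) y)) = 0" if "i < n" for i
      proof (rule poly_eqI)
        fix j
        have "a i $ k * coeff ((theta ^^ i) y) j $ (m - k) = 0" if "k \<le> m" for k
        proof (cases "k = 0")
          case True
          then show ?thesis using a \<open>i < n\<close> by simp
        next
          case nz: False
          then have "slice (m - k) ((theta ^^ i) y) = 0" using False by (intro lower) simp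
          then show ?thesis by (metis coeff_slice coeff_0 mult_zero_right)
        qed
        then show "coeff (slice m (smult (a i) ((theta ^^ i) y))) j = coeff 0 j"
          by (simp add: coeff_slice fps_mult_nth del: mult_eq_0_iff)
      qed
      then have "slice m (diff_op n a y) = (N ^^ n) (slice m y)"
        by (simp add: diff_op_def theta_op_def slice_add slice_sum pow)
      then have "(N ^^ n) (slice m y) = 0" using y by simp
      moreover have "c = 0" if "(N ^^ i) c = 0" for i c
        using that
      proof (induction i)
        case (Suc i)
        then have "smult (of_nat m) ((N ^^ i) c) + pderiv ((N ^^ i) c) = 0"
          using N_def[of "(N ^^ i) c"] by simp
        then have "(N ^^ i) c = 0" using mult_plus_pderiv_inj False by blast
        then show ?case by (rule Suc.IH)
      qed simp
      ultimately show ?thesis by blast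
    qed
  qed
  then show ?thesis
    by (intro poly_eqI fps_ext) (metis coeff_slice coeff_0 fps_zero_nth)
qed

text \<open>
  A solution transformed by the Frobenius structure is identified by its slice at \<open>t = 0\<close>, because
  that slice depends on the constant terms of the operator alone (\<open>slice_0_theta_op\<close>).
\<close>

corollary solution_eqI:
  fixes a :: "nat \<Rightarrow> 'a::field_char_0 fps"
  assumes "\<And>i. i < n \<Longrightarrow> a i $ 0 = 0" and "diff_op n a y = 0" and "diff_op n a z = 0"
    and "slice 0 y = slice 0 z"
  shows "y = z"
proof -
  have neg: "y - z = y + smult (fps_const (- 1)) z" by (simp add: fps_const_neg[symmetric])
  have "slice 0 (y - z) = 0"
    unfolding neg using assms(4) by (simp add: slice_add slice_0_smult)
  moreover have "diff_op n a (y - z) = 0"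
    unfolding neg diff_op_add diff_op_smult_const using assms by simp
  ultimately have "y - z = 0" using solution_eq_0 assms(1) by blast
  then show ?thesis by simp
qed

lemma sum_first_three:
  fixes f :: "nat \<Rightarrow> 'b::comm_monoid_add"
  assumes "n \<ge> 3" and "\<And>i. i \<ge> 3 \<Longrightarrow> f i = 0"
  shows "(\<Sum>i<n. f i) = f 0 + f 1 + f 2"
proof -
  have "(\<Sum>i<n. f i) = (\<Sum>i<3. f i)"
    using assms by (intro sum.mono_neutral_right) auto
  then show ?thesis by (simp add: numeral_3_eq_3 numeral_2_eq_2)
qed

text \<open>
  The slices at \<open>t = 0\<close> of \<open>y\<^sub>0, y\<^sub>1, y\<^sub>2\<close> have degree at most two in \<open>log t\<close>, so only the first
  three Frobenius constants act on them.
\<close>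

lemma constant_coeff_op_quadratic:
  fixes x y z :: "'a::field_char_0"
  assumes "n \<ge> 3"
  shows "(\<Sum>i<n. smult (c i) ((pderiv ^^ i) [:x, y, z:])) =
    smult (c 0) [:x, y, z:] + smult (c 1) [:y, 2 * z:] + smult (c 2) [:2 * z:]"
proof -
  have 2: "(pderiv ^^ 2) [:x, y, z:] = [:2 * z:]"
    by (simp add: numeral_2_eq_2 pderiv_pCons)
  have "(pderiv ^^ i) [:x, y, z:] = 0" if "i \<ge> 3" for i
  proof -
    have z: "(pderiv ^^ j) (0 :: 'a poly) = 0" for j by (induction j) simp_all
    have "(pderiv ^^ i) [:x, y, z:] = (pderiv ^^ (i - 3)) ((pderiv ^^ 3) [:x, y, z:])"
      using that by (simp add: funpow_add[symmetric, THEN fun_cong, unfolded o_apply])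
    also have "(pderiv ^^ 3) [:x, y, z:] = 0"
      by (simp add: numeral_3_eq_3 pderiv_pCons)
    finally show ?thesis by (simp add: z)
  qed
  then have "(\<Sum>i<n. smult (c i) ((pderiv ^^ i) [:x, y, z:])) =
      smult (c 0) ((pderiv ^^ 0) [:x, y, z:]) + smult (c 1) ((pderiv ^^ 1) [:x, y, z:]) +
      smult (c 2) ((pderiv ^^ 2) [:x, y, z:])"
    using assms by (intro sum_first_three) auto
  then show ?thesis by (simp add: 2 pderiv_pCons)
qed


section \<open>Change of derivation\<close>

text \<open>
  The derivation \<open>\<theta>\<^sub>q = q d/dq\<close> written in the variable \<open>t\<close>, where \<open>u\<close> stands for the inverse of
  \<open>\<theta> (log q)\<close>.
\<close>

definition theta_q :: "'a::idom fps \<Rightarrow> 'a fps poly \<Rightarrow> 'a fps poly"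
  where "theta_q u y = smult u (theta y)"

lemma theta_q_0 [simp]: "theta_q u 0 = 0"
  by (simp add: theta_q_def)

lemma theta_q_pow_0 [simp]: "(theta_q u ^^ i) 0 = 0"
  by (induction i) simp_all

lemma theta_q_pow_add: "(theta_q u ^^ i) (y + z) = (theta_q u ^^ i) y + (theta_q u ^^ i) z"
  by (induction i) (simp_all add: theta_q_def theta_add smult_add_right)

lemma theta_q_pow_smult_const:
  "(theta_q u ^^ i) (smult (fps_const c) y) = smult (fps_const c) ((theta_q u ^^ i) y)"
  by (induction i) (simp_all add: theta_q_def theta_smult_const mult.commute)

lemma theta_q_const_poly: "theta_q u [:f:] = [:u * fps_XD f:]"
  by (simp add: theta_q_def theta_def map_poly_pCons pderiv_pCons fps_XD_def)

lemma theta_q_pow_const_poly: "(theta_q u ^^ i) [:f:] = [:((\<lambda>f. u * fps_XD f) ^^ i) f:]"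
  by (induction i) (simp_all add: theta_q_const_poly)

context coeff_subring
begin

text \<open>
  The operators in \<open>\<theta>\<^sub>q\<close> of order less than \<open>n\<close> with integral coefficients, as maps: conjugation
  by a power series is then composition of functions.
\<close>

definition operators :: "'a fps \<Rightarrow> nat \<Rightarrow> ('a fps poly \<Rightarrow> 'a fps poly) set"
  where "operators u n = {P. \<exists>c. (\<forall>j. c j \<in> series) \<and>
    (\<forall>y. P y = (\<Sum>j<n. smult (c j) ((theta_q u ^^ j) y)))}"

lemma operatorsI:
  "(\<And>j. c j \<in> series) \<Longrightarrow> (\<And>y. P y = (\<Sum>j<n. smult (c j) ((theta_q u ^^ j) y))) \<Longrightarrow>
    P \<in> operators u n"
  unfolding operators_def by blast

lemma operatorsE:
  assumes "P \<in> operators u n"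
  obtains c where "\<And>j. c j \<in> series"
    and "\<And>y. P y = (\<Sum>j<n. smult (c j) ((theta_q u ^^ j) y))"
  using assms unfolding operators_def by blast

lemma operators_mono:
  assumes "P \<in> operators u m" and "m \<le> n"
  shows "P \<in> operators u n"
proof -
  obtain c where c: "\<And>j. c j \<in> series"
    and P: "\<And>y. P y = (\<Sum>j<m. smult (c j) ((theta_q u ^^ j) y))"
    using assms(1) by (rule operatorsE) blast
  have "P y = (\<Sum>j<n. smult (if j < m then c j else 0) ((theta_q u ^^ j) y))" for y
    unfolding P using assms(2) by (intro sum.mono_neutral_cong_left) auto
  moreover have "(if j < m then c j else 0) \<in> series" for j using c series_zero by simp
  ultimately show ?thesis by (rule operatorsI[rotated])
qed

lemma operators_smult:
  assumes "P \<in> operators u n" and f: "f \<in> series"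
  shows "(\<lambda>y. smult f (P y)) \<in> operators u n"
proof -
  obtain c where c: "\<And>j. c j \<in> series"
    and P: "\<And>y. P y = (\<Sum>j<n. smult (c j) ((theta_q u ^^ j) y))"
    using assms(1) by (rule operatorsE) blast
  have "smult f (P y) = (\<Sum>j<n. smult (f * c j) ((theta_q u ^^ j) y))" for y
    by (simp add: P smult_sum_right)
  moreover have "f * c j \<in> series" for j using c f series_mult by simp
  ultimately show ?thesis by (rule operatorsI[rotated])
qed

lemma operators_add:
  assumes "P \<in> operators u n" and "P' \<in> operators u n"
  shows "(\<lambda>y. P y + P' y) \<in> operators u n"
proof -
  obtain c where c: "\<And>j. c j \<in> series"
    and P: "\<And>y. P y = (\<Sum>j<n. smult (c j) ((theta_q u ^^ j) y))"
    using assms(1) by (rule operatorsE) blast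
  obtain c' where c': "\<And>j. c' j \<in> series"
    and P': "\<And>y. P' y = (\<Sum>j<n. smult (c' j) ((theta_q u ^^ j) y))"
    using assms(2) by (rule operatorsE) blast
  have "P y + P' y = (\<Sum>j<n. smult (c j + c' j) ((theta_q u ^^ j) y))" for y
    by (simp add: P P' smult_add_left sum.distrib)
  moreover have "c j + c' j \<in> series" for j using c c' series_add by simp
  ultimately show ?thesis by (rule operatorsI[rotated])
qed

lemma operators_zero: "(\<lambda>y. 0) \<in> operators u n"
  by (rule operatorsI[of "\<lambda>_. 0"]) (simp_all add: series_zero)

lemma operators_sum:
  "(\<And>i. i \<in> I \<Longrightarrow> P i \<in> operators u n) \<Longrightarrow> (\<lambda>y. \<Sum>i\<in>I. P i y) \<in> operators u n"
  by (induction I rule: infinite_finite_induct) (auto intro: operators_add operators_zero)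

text \<open>
  By the Leibniz rule \<open>\<theta> (c \<theta>\<^sub>q\<^sup>j) = (\<theta> c) \<theta>\<^sub>q\<^sup>j + c g \<theta>\<^sub>q\<^sup>j\<^sup>+\<^sup>1\<close> with \<open>g = \<theta> (log q)\<close>: the
  order goes up by one and no denominators appear.
\<close>

lemma operators_theta:
  assumes "P \<in> operators u n" and g: "g \<in> series" and gu: "g * u = 1"
  shows "(\<lambda>y. theta (P y)) \<in> operators u (Suc n)"
proof -
  obtain c where c: "\<And>j. c j \<in> series"
    and P: "\<And>y. P y = (\<Sum>j<n. smult (c j) ((theta_q u ^^ j) y))"
    using assms(1) by (rule operatorsE) blast
  define c' where "c' j = (if j < n then fps_XD (c j) else 0) +
    (case j of 0 \<Rightarrow> 0 | Suc i \<Rightarrow> c i * g)" for j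
  have "theta (P y) = (\<Sum>j<Suc n. smult (c' j) ((theta_q u ^^ j) y))" for y
  proof -
    have "theta (P y) = (\<Sum>j<n. smult (fps_XD (c j)) ((theta_q u ^^ j) y)) +
        (\<Sum>j<n. smult (c j * g) ((theta_q u ^^ Suc j) y))"
      using gu by (simp add: P theta_sum theta_smult sum.distrib theta_q_def mult.assoc)
    also have "(\<Sum>j<n. smult (c j * g) ((theta_q u ^^ Suc j) y)) =
        (\<Sum>j<Suc n. smult (case j of 0 \<Rightarrow> 0 | Suc i \<Rightarrow> c i * g) ((theta_q u ^^ j) y))"
      by (subst sum.lessThan_Suc_shift) simp
    also have "(\<Sum>j<n. smult (fps_XD (c j)) ((theta_q u ^^ j) y)) =
        (\<Sum>j<Suc n. smult (if j < n then fps_XD (c j) else 0) ((theta_q u ^^ j) y))"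
      by simp
    finally show ?thesis
      by (simp only: c'_def smult_add_left sum.distrib)
  qed
  moreover have "c' j \<in> series" for j
    unfolding c'_def using c g
    by (auto split: nat.splits intro!: series_add series_mult series_XD series_zero)
  ultimately show ?thesis by (rule operatorsI[rotated])
qed

text \<open>
  Applied with \<open>f = F\<^sub>0\<^sup>\<sigma>\<close> and \<open>h = 1/F\<^sub>0\<close>, this turns the Frobenius structure into an operator on
  the ratios \<open>y\<^sub>i/y\<^sub>0\<close>, which are \<open>1\<close>, \<open>log q\<close> and \<open>log\<^sup>2 q/2 + V\<close>.
\<close>

lemma theta_op_in_operators:
  assumes "\<And>i. i < n \<Longrightarrow> A i \<in> series" and "f \<in> series" and "h \<in> series"
    and "g \<in> series" and "g * u = 1"
  shows "(\<lambda>y. smult h (theta_op n A (smult f y))) \<in> operators u n"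
proof -
  have pow: "(\<lambda>y. (theta ^^ i) (smult f y)) \<in> operators u (Suc i)" for i
  proof (induction i)
    case 0
    have "(\<lambda>y. smult f y) \<in> operators u (Suc 0)"
      using assms(2) by (intro operatorsI[of "\<lambda>_. f"]) simp_all
    then show ?case by simp
  next
    case (Suc i)
    then show ?case using operators_theta[OF Suc assms(4,5)] by simp
  qed
  show ?thesis
    unfolding theta_op_def using assms(1,3)
    by (intro operators_smult operators_sum operators_mono[OF pow]) auto
qed

end


section \<open>The canonical coordinate and its Frobenius lift\<close>

lemma fps_shift_mult_X_power:
  fixes f :: "'a::comm_ring_1 fps"
  shows "fps_shift k (fps_X ^ k * f) = f"
  by (rule fps_ext) (simp add: fps_X_power_mult_nth)

locale canonical_coordinate =
  fixes F :: "nat \<Rightarrow> 'a::field_char_0 fps"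
  assumes F0: "F 0 $ 0 = 1" and F1: "F 1 $ 0 = 0"
begin

abbreviation E where "E \<equiv> exp_ratio F"
abbreviation Q where "Q \<equiv> canonical_coord F"
abbreviation T where "T \<equiv> fps_inv Q"

text \<open>
  Here \<open>log q = log t + G\<close> is an element of \<open>K[[t]][log t]\<close>, and \<open>V\<close> is still a series in \<open>t\<close>;
  it becomes a series in \<open>q\<close> by substituting \<open>t = T(q)\<close>.
\<close>

definition G where "G = F 1 / F 0"
definition V where "V = F 2 / F 0 - fps_const (1/2) * G\<^sup>2"
definition u where "u = inverse (1 + fps_XD G)"
definition log_q where "log_q = [:G, 1:]"
definition half_log_q_sq where "half_log_q_sq = [:fps_const (1/2) * G\<^sup>2, G, fps_const (1/2):]"

lemma F1_eq: "F 1 = F 0 * G"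
  using inverse_mult_eq_1'[of "F 0"] F0
  by (simp only: G_def fps_divide_unit mult.left_commute[of "F 0"]) simp

lemma F2_eq: "F 2 = F 0 * (V + fps_const (1/2) * G\<^sup>2)"
proof -
  have "V + fps_const (1/2) * G\<^sup>2 = F 2 * inverse (F 0)"
    using F0 by (simp add: V_def fps_divide_unit)
  then show ?thesis using inverse_mult_eq_1'[of "F 0"] F0 by (simp add: mult.left_commute)
qed

lemma G0 [simp]: "G $ 0 = 0"
  using arg_cong[OF F1_eq, of "\<lambda>f. f $ 0"] F0 F1 by simp

lemma E_eq: "E = fps_exp 1 oo G"
  by (simp add: exp_ratio_def G_def)

lemma E0 [simp]: "E $ 0 = 1"
  by (simp add: E_eq)

lemma E_deriv: "fps_deriv E = E * fps_deriv G"
  by (simp add: E_eq fps_compose_deriv)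

lemma Q_eq: "Q = fps_X * E"
  by (simp add: canonical_coord_def)

lemma Q0 [simp]: "Q $ 0 = 0" and Q1 [simp]: "Q $ Suc 0 = 1"
  by (simp_all add: Q_eq)

lemma T0 [simp]: "T $ 0 = 0"
  by (simp add: fps_inv_def)

lemma Q_T: "Q oo T = fps_X"
  by (auto intro: fps_inv_right)

lemma u_unit: "u * (1 + fps_XD G) = 1"
  by (simp add: u_def inverse_mult_eq_1)

lemma u_theta_Q: "u * fps_XD Q = Q"
proof -
  have "fps_XD Q = Q * (1 + fps_XD G)"
    by (simp add: Q_eq fps_XD_def E_deriv algebra_simps)
  then show ?thesis using u_unit by (metis mult.left_commute mult.right_neutral)
qed

text \<open>
  Differentiating \<open>Q(T(q)) = q\<close> and using \<open>u \<theta> Q = Q\<close> gives \<open>q T'(q) = u(T(q)) T(q)\<close>; the rest is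
  the chain rule.
\<close>

lemma theta_q_in_q: "(u * fps_XD f) oo T = fps_XD (f oo T)"
proof -
  have "(fps_deriv Q oo T) * fps_deriv T = 1"
    using arg_cong[OF Q_T, of fps_deriv] by (simp add: fps_compose_deriv)
  moreover have "(u oo T) * (T * (fps_deriv Q oo T)) = fps_X"
    using arg_cong[OF u_theta_Q, of "\<lambda>f. f oo T"]
    by (simp add: fps_compose_mult_distrib fps_XD_def Q_T)
  ultimately have "(u oo T) * T = fps_X * fps_deriv T"
    by (metis (no_types, lifting) mult.assoc mult.right_neutral)
  then show ?thesis
    by (simp add: fps_XD_def fps_compose_deriv fps_compose_mult_distrib mult_ac)
qed

lemma theta_q_pow_in_q: "((\<lambda>f. u * fps_XD f) ^^ i) f oo T = (fps_XD ^^ i) (f oo T)"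
  by (induction i) (simp_all add: theta_q_in_q)

lemma half_one: "fps_const (1/2 :: 'a) * 2 = 1" "2 * fps_const (1/2 :: 'a) = 1"
proof -
  have "fps_const (1/2 :: 'a) * fps_const 2 = 1"
    by (simp only: fps_const_mult) simp
  then show "fps_const (1/2 :: 'a) * 2 = 1" "2 * fps_const (1/2 :: 'a) = 1"
    by (simp_all only: numeral_fps_const mult.commute)
qed

lemma theta_q_log_q: "theta_q u log_q = 1"
proof -
  have "theta log_q = [:1 + fps_XD G:]"
    by (simp add: log_q_def theta_def map_poly_pCons pderiv_pCons fps_XD_def)
  then show ?thesis using u_unit by (simp add: theta_q_def one_pCons)
qed

lemma theta_q_half_log_q_sq: "theta_q u half_log_q_sq = log_q"
proof -
  have "theta half_log_q_sq = smult (1 + fps_XD G) log_q"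
  proof -
    have "fps_XD (fps_const (1/2) * G\<^sup>2) = G * fps_XD G"
    proof -
      have "fps_XD (fps_const (1/2) * G\<^sup>2) = (fps_const (1/2) * 2) * (G * fps_XD G)"
        by (simp add: fps_XD_def power2_eq_square algebra_simps)
      then show ?thesis by (simp only: half_one mult_1)
    qed
    then show ?thesis
      by (simp add: theta_def half_log_q_sq_def log_q_def map_poly_pCons pderiv_pCons algebra_simps
          half_one fps_XD_def)
  qed
  then show ?thesis using u_unit by (simp add: theta_q_def)
qed

lemma theta_q_pow_half_log_q_sq:
  assumes "i \<ge> 3"
  shows "(theta_q u ^^ i) half_log_q_sq = 0"
proof -
  have "(theta_q u ^^ i) half_log_q_sq = (theta_q u ^^ (i - 3)) ((theta_q u ^^ 3) half_log_q_sq)"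
    using assms by (simp add: funpow_add[symmetric, THEN fun_cong, unfolded o_apply])
  moreover have "(theta_q u ^^ 3) half_log_q_sq = 0"
    by (simp add: numeral_3_eq_3 theta_q_half_log_q_sq theta_q_log_q)
       (simp add: theta_q_def theta_def one_pCons map_poly_pCons fps_XD_def)
  ultimately show ?thesis by simp
qed

lemma log_sol_0: "log_sol F 0 = smult (F 0) 1"
  by (simp add: log_sol_def monom_0 one_pCons)

lemma log_sol_1: "log_sol F 1 = smult (F 0) log_q"
  using F1_eq by (simp add: log_sol_def monom_Suc monom_0 log_q_def)

lemma log_sol_2: "log_sol F 2 = smult (F 0) ([:V:] + half_log_q_sq)"
proof -
  have "log_sol F 2 = [: F 2, F 1, fps_const (1/2) * F 0 :]"
    by (simp add: log_sol_def numeral_2_eq_2 monom_Suc monom_0 add.commute)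
  then show ?thesis by (simp only: F1_eq F2_eq half_log_q_sq_def) (simp add: mult.commute)
qed

text \<open>
  The image \<open>t\<^sup>\<sigma>\<close> of the coordinate \<open>t\<close> under the Frobenius lift.
\<close>

definition tau :: "nat \<Rightarrow> 'a fps" where "tau p = T oo Q ^ p"

context
  fixes p :: nat
  assumes p: "p > 0"
begin

lemma Q_pow_0 [simp]: "(Q ^ p) $ 0 = 0"
  using p by (simp add: fps_power_zeroth power_0_left)

lemma tau_0 [simp]: "tau p $ 0 = 0"
  by (simp add: tau_def)

lemma frob_eq: "frob p Q f = f oo tau p"
  by (simp add: frob_def tau_def fps_compose_assoc)

lemma Q_tau: "Q oo tau p = Q ^ p"
  by (simp add: tau_def fps_compose_assoc Q_T)

lemma frob_in_q: "(f oo tau p) oo T = (f oo T) oo fps_X ^ p"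
proof -
  have "(f oo tau p) oo T = f oo (T oo (Q ^ p oo T))"
    by (simp add: tau_def fps_compose_assoc)
  also have "Q ^ p oo T = fps_X ^ p" by (simp add: fps_compose_power[symmetric] Q_T)
  also have "f oo (T oo fps_X ^ p) = (f oo T) oo fps_X ^ p"
    using p by (intro fps_compose_assoc) (auto simp: power_0_left)
  finally show ?thesis .
qed

text \<open>
  The extension of \<open>\<sigma>\<close> to logarithms is made so that \<open>log q\<close> goes to \<open>p log q\<close>.  Both sides have
  no constant term, and their derivatives are the logarithmic derivatives of the two sides of
  \<open>(t\<^sup>\<sigma>/t\<^sup>p) E(t\<^sup>\<sigma>) = E\<^sup>p\<close>, which is \<open>q\<^sup>\<sigma> = q\<^sup>p\<close> divided by \<open>t\<^sup>p\<close>.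
\<close>

lemma frob_log_q:
  "(fps_ln 1 oo (fps_shift p (tau p) - 1)) + (G oo tau p) = of_nat p * G"
proof -
  define e where "e = fps_shift p (tau p)"
  define l where "l = fps_ln 1 oo (e - 1)"
  define s where "s = E oo tau p"
  have s0: "s $ 0 = 1" by (simp add: s_def)
  have s_nz: "s \<noteq> 0" using s0 by (metis fps_zero_nth zero_neq_one)
  have "tau p * s = Q ^ p"
    using Q_tau by (simp add: Q_eq fps_compose_mult_distrib s_def)
  then have ts: "tau p * s = fps_X ^ p * E ^ p" by (simp add: Q_eq power_mult_distrib)
  have "tau p = fps_X ^ p * (E ^ p * inverse s)"
  proof -
    have "tau p * (s * inverse s) = fps_X ^ p * (E ^ p * inverse s)"
      using ts by (metis mult.assoc)
    then show ?thesis using s0 by (simp add: inverse_mult_eq_1')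
  qed
  then have "e = E ^ p * inverse s" by (simp add: e_def fps_shift_mult_X_power)
  then have es: "e * s = E ^ p" using s0 by (simp add: inverse_mult_eq_1 mult.assoc)
  have e0: "e $ 0 = 1" using arg_cong[OF es, of "\<lambda>f. f $ 0"] s0 by (simp add: fps_power_zeroth)
  have e_nz: "e \<noteq> 0" using e0 by (metis fps_zero_nth zero_neq_one)
  have le: "e * fps_deriv l = fps_deriv e"
  proof -
    have "fps_deriv l = (inverse (1 + fps_X) oo (e - 1)) * fps_deriv e"
      by (simp add: l_def fps_compose_deriv e0 fps_ln_deriv)
    also have "inverse (1 + fps_X) oo (e - 1) = inverse ((1 + fps_X) oo (e - 1))"
      by (rule fps_inverse_compose) (simp_all add: e0)
    also have "(1 + fps_X) oo (e - 1) = e"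
      by (simp add: fps_compose_add_distrib e0)
    finally show ?thesis using e0 by (simp add: inverse_mult_eq_1' mult.assoc[symmetric])
  qed
  have sG: "s * fps_deriv (G oo tau p) = fps_deriv s"
    by (simp add: s_def fps_compose_deriv E_deriv fps_compose_mult_distrib mult.assoc)
  have "e * s * (fps_deriv l + fps_deriv (G oo tau p)) = fps_deriv (e * s)"
    by (simp add: le[symmetric] sG[symmetric] algebra_simps)
  also have "\<dots> = e * s * (of_nat p * fps_deriv G)"
  proof -
    have "E ^ p = E * E ^ (p - 1)" using p by (cases p) simp_all
    then show ?thesis
      unfolding es fps_deriv_power E_deriv fps_of_nat by (simp only: mult_ac)
  qed
  finally have "fps_deriv l + fps_deriv (G oo tau p) = of_nat p * fps_deriv G"
    using e_nz s_nz by (metis mult_left_cancel mult_eq_0_iff)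
  then have "fps_deriv (l + (G oo tau p)) = fps_deriv (of_nat p * G)"
    by simp
  moreover have "(l + (G oo tau p)) $ 0 = (of_nat p * G) $ 0"
    by (simp add: l_def)
  ultimately have "l + (G oo tau p) = of_nat p * G"
    by (simp only: fps_deriv_eq_iff) simp
  then show ?thesis by (simp add: l_def e_def)
qed

lemma frob_log_sol_0: "frob_log p Q (log_sol F 0) = smult (F 0 oo tau p) 1"
  by (simp add: frob_log_def log_sol_def monom_0 map_poly_pCons frob_eq one_pCons)

lemma frob_log_sol_1: "frob_log p Q (log_sol F 1) = smult (F 0 oo tau p) (smult (of_nat p) log_q)"
proof -
  have "log_sol F 1 = [:F 0 * G, F 0:]"
    by (simp only: log_sol_1 log_q_def) simp
  then have "map_poly (frob p Q) (log_sol F 1) = smult (F 0 oo tau p) [:G oo tau p, 1:]"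
    by (simp only:) (simp add: map_poly_pCons frob_eq fps_compose_mult_distrib)
  moreover have "pcompose [:G oo tau p, 1:] [:fps_ln 1 oo (fps_shift p (tau p) - 1), of_nat p:] =
      smult (of_nat p) log_q"
    using frob_log_q by (simp add: pcompose_pCons log_q_def add.commute)
  ultimately show ?thesis
    by (simp only: frob_log_def pcompose_smult frob_eq fps_X_fps_compose_startby0 tau_0)
qed

lemma frob_log_sol_2:
  "frob_log p Q (log_sol F 2) =
    smult (F 0 oo tau p) ([:V oo tau p:] + smult (of_nat p ^ 2) half_log_q_sq)"
proof -
  define l where "l = fps_ln 1 oo (fps_shift p (tau p) - 1)"
  define g where "g = G oo tau p"
  define h :: "'a fps" where "h = fps_const (1/2)"
  have l: "l = of_nat p * G - g"
    using frob_log_q by (simp add: l_def g_def eq_diff_eq)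
  have h: "h + h = 1" using half_one by (simp add: h_def mult_2)
  have "log_sol F 2 = [:F 0 * (V + h * G\<^sup>2), F 0 * G, F 0 * h:]"
    by (simp add: log_sol_2 half_log_q_sq_def h_def)
  then have "map_poly (frob p Q) (log_sol F 2) =
      smult (F 0 oo tau p) [:(V oo tau p) + h * g\<^sup>2, g, h:]"
    by (simp only:) (simp add: map_poly_pCons frob_eq fps_compose_mult_distrib
        fps_compose_add_distrib power2_eq_square g_def h_def)
  then have "frob_log p Q (log_sol F 2) = smult (F 0 oo tau p)
      (pcompose [:(V oo tau p) + h * g\<^sup>2, g, h:] [:l, of_nat p:])"
    by (simp only: frob_log_def pcompose_smult frob_eq fps_X_fps_compose_startby0 tau_0 l_def)
  also have "pcompose [:(V oo tau p) + h * g\<^sup>2, g, h:] [:l, of_nat p:] =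
      [:V oo tau p:] + smult (of_nat p ^ 2) half_log_q_sq"
  proof -
    have 1: "(V oo tau p) + h * g\<^sup>2 + l * (g + l * h) = (V oo tau p) + of_nat p ^ 2 * (h * G\<^sup>2)"
    proof -
      have "h * g\<^sup>2 + l * (g + l * h) = of_nat p ^ 2 * (h * G\<^sup>2) +
          (1 - (h + h)) * (of_nat p * G * g - g\<^sup>2)"
        unfolding l by (simp add: algebra_simps power2_eq_square)
      then show ?thesis by (simp add: h add.assoc)
    qed
    have 2: "l * (of_nat p * h) + of_nat p * (g + l * h) = of_nat p ^ 2 * G"
    proof -
      have "l * (of_nat p * h) + of_nat p * (g + l * h) =
          (h + h) * of_nat p * l + of_nat p * g" by (simp add: algebra_simps)
      then show ?thesis by (simp add: h l algebra_simps power2_eq_square)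
    qed
    have "pcompose [:(V oo tau p) + h * g\<^sup>2, g, h:] [:l, of_nat p:] =
        [:(V oo tau p) + h * g\<^sup>2 + l * (g + l * h),
          l * (of_nat p * h) + of_nat p * (g + l * h), of_nat p ^ 2 * h:]"
      by (simp add: pcompose_pCons algebra_simps power2_eq_square)
    also have "\<dots> = [:(V oo tau p) + of_nat p ^ 2 * (h * G\<^sup>2), of_nat p ^ 2 * G, of_nat p ^ 2 * h:]"
      by (simp only: 1 2)
    finally show ?thesis by (simp add: half_log_q_sq_def h_def[symmetric])
  qed
  finally show ?thesis .
qed

end

end


section \<open>Integrality from a Frobenius structure\<close>

text \<open>
  Integrality of \<open>V(q) - p\<^sup>-\<^sup>2 V(q\<^sup>p)\<close> is a statement about an arbitrary subring of coefficients: its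
  driving force is that \<open>t\<^sup>\<sigma> = t\<^sup>p + \<dots>\<close> with \<open>p \<ge> 2\<close> turns functional equations into recursions.
\<close>

locale integral_frobenius = canonical_coordinate F + coeff_subring R
  for F :: "nat \<Rightarrow> 'a::field_char_0 fps" and R :: "'a set" +
  fixes n p :: nat and a A :: "nat \<Rightarrow> 'a fps"
  assumes n3: "n \<ge> 3" and p2: "p \<ge> 2"
    and a0: "\<And>i. i < n \<Longrightarrow> a i $ 0 = 0"
    and sol: "\<And>i. i < n \<Longrightarrow> diff_op n a (log_sol F i) = 0"
    and F2: "F 2 $ 0 = 0"
    and E_series: "exp_ratio F \<in> series"
    and A_series: "\<And>i. i < n \<Longrightarrow> A i \<in> series"
    and A_0: "A 0 $ 0 = 1" and A_1: "A 1 $ 0 = 0"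
    and frobenius: "\<And>y. diff_op n a y = 0 \<Longrightarrow>
      diff_op n a (theta_op n A (frob_log p (canonical_coord F) y)) = 0"
begin

lemma p_pos: "p > 0"
  using p2 by simp

lemma V0: "V $ 0 = 0"
  using arg_cong[OF F2_eq, of "\<lambda>f. f $ 0"] F0 F2 by (simp add: power2_eq_square)

lemma slice_log_q: "slice 0 log_q = [:0, 1:]"
  by (simp add: slice_def log_q_def map_poly_pCons)

lemma slice_half_log_q_sq: "slice 0 half_log_q_sq = [:0, 0, 1/2:]"
  by (simp add: slice_def half_log_q_sq_def map_poly_pCons power2_eq_square)

lemma slice_one: "slice 0 (1 :: 'a fps poly) = [:1:]"
  by (simp add: slice_def one_pCons map_poly_pCons)

lemma slice_const: "slice 0 [:f:] = [:f $ 0:]"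
  by (simp add: slice_def map_poly_pCons)

lemma frobenius_log_sol:
  assumes "i < n" and "diff_op n a z = 0"
    and "slice 0 (theta_op n A (frob_log p Q (log_sol F i))) = slice 0 z"
  shows "theta_op n A (frob_log p Q (log_sol F i)) = z"
  by (rule solution_eqI[OF a0 frobenius[OF sol[OF assms(1)]] assms(2,3)])

abbreviation s where "s \<equiv> F 0 oo tau p"

lemma frobenius_1: "theta_op n A (smult s 1) = smult (F 0) 1"
proof -
  have "slice 0 (theta_op n A (smult s 1)) = slice 0 (log_sol F 0)"
    using constant_coeff_op_quadratic[OF n3, of "\<lambda>i. A i $ 0" 1 0 0]
    by (simp only: slice_0_theta_op slice_0_smult slice_one log_sol_0) (simp add: F0 A_0)
  then show ?thesis
    using frobenius_log_sol[of 0 "log_sol F 0"] sol[of 0] n3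
    unfolding frob_log_sol_0[OF p_pos] unfolding log_sol_0 by simp
qed

text \<open>
  This is where \<open>\<alpha>\<^sub>1 = 0\<close> enters: in general \<open>y\<^sub>1\<^sup>\<sigma>\<close> is sent to \<open>p (y\<^sub>1 + \<alpha>\<^sub>1 y\<^sub>0)\<close>.
\<close>

lemma frobenius_log_q:
  "theta_op n A (smult s (smult (of_nat p) log_q)) = smult (F 0) (smult (of_nat p) log_q)"
proof -
  define z where "z = smult (fps_const (of_nat p)) (log_sol F 1)"
  have z: "z = smult (F 0) (smult (of_nat p) log_q)"
    unfolding z_def log_sol_1 by (simp add: fps_of_nat mult.commute)
  have "slice 0 (theta_op n A (smult s (smult (of_nat p) log_q))) = slice 0 z"
    using constant_coeff_op_quadratic[OF n3, of "\<lambda>i. A i $ 0" 0 "of_nat p" 0]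
    by (simp add: slice_0_theta_op slice_0_smult slice_log_q z F0 A_0 A_1[simplified])
  moreover have "diff_op n a z = 0"
    unfolding z_def diff_op_smult_const using sol[of 1] n3 by simp
  ultimately show ?thesis
    using frobenius_log_sol[of 1 z] n3 unfolding z frob_log_sol_1[OF p_pos] by simp
qed

lemma frobenius_log_q_sq:
  "theta_op n A (smult s ([:V oo tau p:] + smult (of_nat p ^ 2) half_log_q_sq)) =
    smult (F 0) (smult (of_nat p ^ 2) ([:V + fps_const (A 2 $ 0):] + half_log_q_sq))"
proof -
  define z where "z = smult (fps_const (of_nat p ^ 2)) (log_sol F 2) +
    smult (fps_const (of_nat p ^ 2 * A 2 $ 0)) (log_sol F 0)"
  have pp: "fps_const (of_nat p ^ 2 :: 'a) = of_nat p ^ 2"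
    by (simp add: fps_of_nat[symmetric] power2_eq_square)
  have z: "z = smult (F 0) (smult (of_nat p ^ 2)
      ([:V + fps_const (A 2 $ 0):] + half_log_q_sq))"
    unfolding z_def log_sol_2 log_sol_0 fps_const_mult[symmetric] pp
    by (rule poly_eqI) (simp add: algebra_simps coeff_pCons split: nat.splits)
  have "slice 0 (theta_op n A (smult s ([:V oo tau p:] + smult (of_nat p ^ 2) half_log_q_sq))) =
      slice 0 z"
    using constant_coeff_op_quadratic[OF n3, of "\<lambda>i. A i $ 0" 0 0 "of_nat p ^ 2 / 2"]
    by (simp add: slice_0_theta_op slice_0_smult slice_add slice_half_log_q_sq slice_const z V0
        F0 A_0 A_1[simplified] fps_power_zeroth mult.commute)
  moreover have "diff_op n a z = 0"
    unfolding z_def diff_op_add diff_op_smult_const using sol[of 2] sol[of 0] n3 by simp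
  ultimately show ?thesis
    using frobenius_log_sol[of 2 z] n3 unfolding z frob_log_sol_2[OF p_pos] by simp
qed

lemma Q_series: "Q \<in> series"
  unfolding Q_eq using E_series by (intro series_mult series_X)

lemma T_series: "T \<in> series"
  using Q_series by (intro series_compositional_inverse) auto

lemma tau_series: "tau p \<in> series"
  unfolding tau_def using Q_series T_series by (intro series_compose series_power)

lemma tau_1: "tau p $ 1 = 0"
proof -
  have "Q ^ p $ 1 = 0"
    using p2 by (simp add: Q_eq power_mult_distrib fps_X_power_mult_nth)
  then show ?thesis by (simp add: tau_def fps_compose_nth)
qed

text \<open>
  The recursion that \<open>L\<close> itself gives for the coefficients of \<open>F\<^sub>0\<close> divides the \<open>m\<close>-th one by
  \<open>m\<^sup>n\<close>.  The functional equation \<open>F\<^sub>0 = \<A>(F\<^sub>0\<^sup>\<sigma>)\<close> determines it from earlier coefficients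
  without division.
\<close>

lemma F0_series: "F 0 \<in> series"
proof -
  have "theta_op n A [:s:] = [:\<Sum>i<n. A i * (fps_XD ^^ i) s:]"
  proof -
    have "(theta ^^ i) [:s:] = [:(fps_XD ^^ i) s:]" for i
      by (induction i) (simp_all add: theta_def map_poly_pCons pderiv_pCons fps_XD_def)
    moreover have "(\<Sum>i\<in>I. [:g i:]) = [:\<Sum>i\<in>I. g i:]" for g :: "nat \<Rightarrow> 'a fps" and I
      by (induction I rule: infinite_finite_induct) simp_all
    ultimately show ?thesis by (simp add: theta_op_def)
  qed
  then have eq: "F 0 = (\<Sum>i<n. A i * (fps_XD ^^ i) s)"
    using frobenius_1 by (simp add: one_pCons)
  have "F 0 $ m \<in> R" for m
  proof (induction m rule: less_induct)
    case (less m)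
    show ?case
    proof (cases "m = 0")
      case True
      then show ?thesis using F0 one_closed by simp
    next
      case False
      then have "s \<in> series_upto m"
        using less tau_series tau_0[OF p_pos] tau_1 by (intro series_upto_compose_contracting) auto
      then have "(\<Sum>i<n. A i * (fps_XD ^^ i) s) \<in> series_upto m"
        using A_series
        by (intro series_upto_sum series_upto_mult series_upto_XDs) (auto simp: series_iff_upto)
      then show ?thesis by (subst eq) (simp add: series_upto_def)
    qed
  qed
  then show ?thesis by (simp add: series_def)
qed

text \<open>
  Although \<open>G = log E\<close> has denominators, \<open>\<theta> G\<close> is the logarithmic derivative of the integral
  series \<open>E\<close>.
\<close>

lemma theta_log_q_series: "1 + fps_XD G \<in> series"
proof -
  have "fps_XD E = E * fps_XD G" by (simp add: fps_XD_def E_deriv)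
  then have "E + fps_XD E = E * (1 + fps_XD G)" by (simp add: distrib_left)
  then have "inverse E * (E + fps_XD E) = inverse E * E * (1 + fps_XD G)"
    by (simp only: mult.assoc)
  then have "1 + fps_XD G = inverse E * (E + fps_XD E)"
    by (simp add: inverse_mult_eq_1)
  also have "\<dots> \<in> series"
    using E_series by (intro series_mult series_add series_inverse series_XD) auto
  finally show ?thesis .
qed

text \<open>
  The \<open>c\<^sub>j\<close> are the coefficients of \<open>F\<^sub>0\<^sup>-\<^sup>1 \<A> F\<^sub>0\<^sup>\<sigma>\<close> with respect to \<open>\<theta>\<^sub>q\<close>.  This operator fixes
  \<open>1\<close> and \<open>p log q\<close>, which gives \<open>c\<^sub>0 = 1\<close> and \<open>c\<^sub>1 = 0\<close>; the relation is its action on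
  \<open>p\<^sup>2 log\<^sup>2 q/2 + V\<^sup>\<sigma>\<close>, after the terms in \<open>log\<^sup>2 q\<close> have cancelled.
\<close>

lemma frobenius_relation_t:
  obtains c where "\<And>j. c j \<in> series" and "c 0 = 1" and "c 1 = 0"
    and "(\<Sum>j<n. c j * ((\<lambda>f. u * fps_XD f) ^^ j) (V oo tau p)) + of_nat p ^ 2 * c 2 =
      of_nat p ^ 2 * (V + fps_const (A 2 $ 0))"
proof -
  have F0_inv: "inverse (F 0) * F 0 = 1" using F0 by (simp add: inverse_mult_eq_1)
  have "(\<lambda>y. smult (inverse (F 0)) (theta_op n A (smult s y))) \<in> operators u n"
    using A_series F0_series F0 tau_series theta_log_q_series u_unit
    by (intro theta_op_in_operators[of n A s "inverse (F 0)" "1 + fps_XD G"]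
        series_compose series_inverse) (auto simp: mult.commute)
  then obtain c where c: "\<And>j. c j \<in> series" and
    op: "\<And>y. smult (inverse (F 0)) (theta_op n A (smult s y)) =
      (\<Sum>j<n. smult (c j) ((theta_q u ^^ j) y))"
    by (rule operatorsE) blast
  have eval: "(\<Sum>j<n. smult (c j) ((theta_q u ^^ j) y)) = z"
    if "theta_op n A (smult s y) = smult (F 0) z" for y z
    unfolding op[symmetric] that by (simp add: F0_inv)
  have th1: "theta_q u 1 = 0"
    by (simp add: theta_q_def theta_def one_pCons map_poly_pCons fps_XD_def)
  have log_q_Suc: "(theta_q u ^^ Suc j) log_q = (theta_q u ^^ j) 1"
    and one_Suc: "(theta_q u ^^ Suc j) 1 = 0" for j
    by (simp_all only: funpow_Suc_right o_apply theta_q_log_q th1 theta_q_pow_0)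
  have one_ge: "(theta_q u ^^ j) 1 = 0" if "j \<ge> 1" for j
    using one_Suc[of "j - 1"] that by simp
  have log_ge: "(theta_q u ^^ j) log_q = 0" if "j \<ge> 2" for j
    using log_q_Suc[of "j - 1"] one_ge[of "j - 1"] that by simp
  have c0: "c 0 = 1"
  proof -
    have "(\<Sum>j<n. smult (c j) ((theta_q u ^^ j) 1)) = smult (c 0) 1"
      using one_ge by (subst sum_first_three[OF n3]) (auto simp: th1 numeral_2_eq_2)
    then have "smult (c 0) 1 = (1 :: 'a fps poly)" using eval[OF frobenius_1] by simp
    then show ?thesis by (simp add: one_pCons)
  qed
  have smp: "(theta_q u ^^ j) (smult (of_nat k) y) = smult (of_nat k) ((theta_q u ^^ j) y)"
    for j k y using theta_q_pow_smult_const[of j u "of_nat k" y] by (simp add: fps_of_nat)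
  have c1: "c 1 = 0"
  proof -
    have "(\<Sum>j<n. smult (c j) ((theta_q u ^^ j) (smult (of_nat p) log_q))) =
        smult (of_nat p) (smult (c 0) log_q + smult (c 1) 1)"
      using log_ge
      by (subst sum_first_three[OF n3])
         (auto simp: smp smp[of 1, simplified] theta_q_log_q smult_add_right mult.commute)
    then have "smult (of_nat p) (smult (c 0) log_q + smult (c 1) 1) = smult (of_nat p) log_q"
      using eval[OF frobenius_log_q] by simp
    then have "smult (c 0) log_q + smult (c 1) 1 = log_q"
      using p_pos by (metis smult_cancel of_nat_eq_0_iff less_irrefl)
    then show ?thesis using c0 by (simp add: one_pCons)
  qed
  have "(\<Sum>j<n. c j * ((\<lambda>f. u * fps_XD f) ^^ j) (V oo tau p)) + of_nat p ^ 2 * c 2 =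
      of_nat p ^ 2 * (V + fps_const (A 2 $ 0))" (is "?S + _ = _")
  proof -
    define P where "P = (of_nat p ^ 2 :: 'a fps)"
    have P: "(theta_q u ^^ j) (smult P y) = smult P ((theta_q u ^^ j) y)" for j y
      using smp[of j "p ^ 2" y] by (simp add: P_def)
    have "(\<Sum>j<n. smult (c j) ((theta_q u ^^ j) (smult P half_log_q_sq))) =
        smult P half_log_q_sq + [:P * c 2:]"
      using theta_q_pow_half_log_q_sq c0 c1
      by (subst sum_first_three[OF n3])
         (auto simp: P P[of 1, simplified] theta_q_log_q theta_q_half_log_q_sq numeral_2_eq_2 one_pCons)
    then have "(\<Sum>j<n. smult (c j) ((theta_q u ^^ j) (smult (of_nat p ^ 2) half_log_q_sq))) =
        smult (of_nat p ^ 2) half_log_q_sq + [:of_nat p ^ 2 * c 2:]"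
      unfolding P_def .
    moreover have "(\<Sum>j<n. smult (c j) ((theta_q u ^^ j) [:V oo tau p:])) = [:?S:]"
    proof -
      have "(\<Sum>i\<in>I. [:g i:]) = [:\<Sum>i\<in>I. g i:]" for g :: "nat \<Rightarrow> 'a fps" and I
        by (induction I rule: infinite_finite_induct) simp_all
      then show ?thesis by (simp add: theta_q_pow_const_poly)
    qed
    ultimately have "[:?S:] + (smult (of_nat p ^ 2) half_log_q_sq + [:of_nat p ^ 2 * c 2:]) =
        smult (of_nat p ^ 2) ([:V + fps_const (A 2 $ 0):] + half_log_q_sq)"
      using eval[OF frobenius_log_q_sq]
      by (simp only: theta_q_pow_add smult_add_right sum.distrib)
    then have "[:?S + of_nat p ^ 2 * c 2:] = [:of_nat p ^ 2 * (V + fps_const (A 2 $ 0)):]"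
      by (simp add: smult_add_right add.left_commute[of "[:?S:]"] add.commute)
    then show ?thesis by simp
  qed
  then show thesis using that c c0 c1 by blast
qed

definition v where "v = V oo T"

lemma theta_sq_compose_X_power:
  fixes f :: "'a fps"
  shows "fps_XD (fps_XD (f oo fps_X ^ p)) = of_nat p ^ 2 * (fps_XD (fps_XD f) oo fps_X ^ p)"
proof (rule fps_ext)
  fix m
  have pp: "(of_nat p ^ 2 :: 'a fps) = fps_const (of_nat p ^ 2)"
    by (simp add: fps_of_nat[symmetric] power2_eq_square)
  have mult_nth: "(of_nat p ^ 2 * g) $ m = of_nat p ^ 2 * g $ m" for g :: "'a fps"
    unfolding pp by (rule fps_mult_left_const_nth)
  have "fps_XD (fps_XD (f oo fps_X ^ p)) $ m =
      of_nat p ^ 2 * (fps_XD (fps_XD f) oo fps_X ^ p) $ m"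
    unfolding fps_XD_nth fps_nth_compose_X_power
    using p_pos by (auto simp: power2_eq_square elim!: dvdE)
  then show "fps_XD (fps_XD (f oo fps_X ^ p)) $ m =
      (of_nat p ^ 2 * (fps_XD (fps_XD f) oo fps_X ^ p)) $ m"
    by (simp only: mult_nth)
qed

text \<open>
  Since \<open>\<theta>\<^sub>q (f(q\<^sup>p)) = p (\<theta>\<^sub>q f)(q\<^sup>p)\<close> and the terms with \<open>j \<ge> 2\<close> contain at least two
  derivations, the factor \<open>p\<^sup>2\<close> comes out of them.  A term with \<open>j = 1\<close> would provide only one factor
  \<open>p\<close>, but \<open>c\<^sub>1 = 0\<close>.  The series \<open>b\<^sub>j\<close> is \<open>c\<^sub>j\<^sub>+\<^sub>2\<close> in the coordinate \<open>q\<close>, and the separate summand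
  \<open>b\<^sub>0\<close> is its product with \<open>\<theta>\<^sub>q\<^sup>2 (log\<^sup>2 q/2) = 1\<close>.
\<close>

lemma frobenius_relation_q:
  obtains b where "\<And>j. b j \<in> series"
    and "of_nat p ^ 2 * (v + fps_const (A 2 $ 0)) = (v oo fps_X ^ p) + of_nat p ^ 2 *
      (b 0 + (\<Sum>j<n - 2. b j * (fps_XD ^^ j) (fps_XD (fps_XD v) oo fps_X ^ p)))"
proof -
  obtain c where c: "\<And>j. c j \<in> series" and c0: "c 0 = 1" and c1: "c 1 = 0"
    and rel: "(\<Sum>j<n. c j * ((\<lambda>f. u * fps_XD f) ^^ j) (V oo tau p)) + of_nat p ^ 2 * c 2 =
      of_nat p ^ 2 * (V + fps_const (A 2 $ 0))"
    by (rule frobenius_relation_t) blast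
  define d where "d j = c j oo T" for j
  have d: "d j \<in> series" for j unfolding d_def using c T_series by (intro series_compose)
  have d01: "d 0 = 1" "d 1 = 0" by (simp_all only: d_def c0 c1 fps_compose_1 fps_compose_0)
  define w where "w = v oo fps_X ^ p"
  have of_nat_T: "of_nat k oo T = of_nat k" for k by (simp add: fps_of_nat[symmetric])
  have pp_T: "of_nat p ^ 2 oo T = of_nat p ^ 2"
    using of_nat_T[of "p ^ 2"] by simp
  have eq1: "(\<Sum>j<n. d j * (fps_XD ^^ j) w) + of_nat p ^ 2 * d 2 =
      of_nat p ^ 2 * (v + fps_const (A 2 $ 0))"
    using arg_cong[OF rel, of "\<lambda>f. f oo T"]
    by (simp add: fps_compose_add_distrib fps_compose_sum_distrib fps_compose_mult_distrib
        theta_q_pow_in_q frob_in_q[OF p_pos] pp_T d_def w_def v_def)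
  have eq2: "(\<Sum>j<n. d j * (fps_XD ^^ j) w) = w + of_nat p ^ 2 *
      (\<Sum>j<n - 2. d (Suc (Suc j)) * (fps_XD ^^ j) (fps_XD (fps_XD v) oo fps_X ^ p))"
  proof -
    define N where "N = n - 2"
    have N: "n = Suc (Suc N)" using n3 by (simp add: N_def)
    have pw: "(fps_XD ^^ j) (of_nat k * f) = of_nat k * (fps_XD ^^ j) f" for j k and f :: "'a fps"
      by (induction j) (simp_all add: fps_of_nat[symmetric])
    have "(fps_XD ^^ Suc (Suc j)) w =
        of_nat p ^ 2 * (fps_XD ^^ j) (fps_XD (fps_XD v) oo fps_X ^ p)" for j
      using pw[of j "p ^ 2"] unfolding w_def funpow_Suc_right o_apply theta_sq_compose_X_power
      by simp
    then have "(\<Sum>j<N. d (Suc (Suc j)) * (fps_XD ^^ Suc (Suc j)) w) =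
        of_nat p ^ 2 * (\<Sum>j<N. d (Suc (Suc j)) *
          (fps_XD ^^ j) (fps_XD (fps_XD v) oo fps_X ^ p))"
      by (simp only: sum_distrib_left mult.left_commute)
    moreover have "(\<Sum>j<n. d j * (fps_XD ^^ j) w) =
        w + (\<Sum>j<N. d (Suc (Suc j)) * (fps_XD ^^ Suc (Suc j)) w)"
      unfolding N sum.lessThan_Suc_shift using d01 by simp
    ultimately show ?thesis by (simp only: N_def)
  qed
  have "of_nat p ^ 2 * (v + fps_const (A 2 $ 0)) = w + of_nat p ^ 2 *
      (d 2 + (\<Sum>j<n - 2. d (Suc (Suc j)) * (fps_XD ^^ j) (fps_XD (fps_XD v) oo fps_X ^ p)))"
    unfolding eq1[symmetric] eq2 by (simp add: distrib_left add_ac)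
  then show thesis
    using d by (intro that[of "\<lambda>j. d (Suc (Suc j))"]) (simp_all add: w_def numeral_2_eq_2)
qed

text \<open>
  The relation says \<open>V - p\<^sup>-\<^sup>2 V(q\<^sup>p) + \<alpha>\<^sub>2 = W\<close>, where \<open>W\<close> is built with integral coefficients from
  \<open>h(q\<^sup>p)\<close> for \<open>h = \<theta>\<^sub>q\<^sup>2 V\<close>.  Applying \<open>\<theta>\<^sub>q\<^sup>2\<close> gives \<open>h - h(q\<^sup>p) = \<theta>\<^sub>q\<^sup>2 W\<close>, so the \<open>m\<close>-th
  coefficient of \<open>h\<close> is an integral expression in earlier ones.  Hence \<open>h\<close> is integral, and
  therefore so is \<open>W\<close>.
\<close>

theorem frobenius_integrality:
  shows "m > 0 \<Longrightarrow> v $ m - (if p dvd m then v $ (m div p) else 0) / of_nat p ^ 2 \<in> R"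
proof -
  obtain b where b: "\<And>j. b j \<in> series"
    and rel: "of_nat p ^ 2 * (v + fps_const (A 2 $ 0)) = (v oo fps_X ^ p) + of_nat p ^ 2 *
      (b 0 + (\<Sum>j<n - 2. b j * (fps_XD ^^ j) (fps_XD (fps_XD v) oo fps_X ^ p)))"
    by (rule frobenius_relation_q) blast
  define h where "h = fps_XD (fps_XD v)"
  define W where "W = b 0 + (\<Sum>j<n - 2. b j * (fps_XD ^^ j) (h oo fps_X ^ p))"
  define w where "w m = v $ m - (if p dvd m then v $ (m div p) else 0) / of_nat p ^ 2" for m
  have pp: "(of_nat p ^ 2 :: 'a fps) = fps_const (of_nat p ^ 2)"
    by (simp add: fps_of_nat[symmetric] power2_eq_square)
  have p_nz: "(of_nat p :: 'a) \<noteq> 0" using p_pos by simp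
  have w: "w m = W $ m" if "m > 0" for m
  proof -
    have "of_nat p ^ 2 * v $ m = (if p dvd m then v $ (m div p) else 0) + of_nat p ^ 2 * W $ m"
      using arg_cong[OF rel[folded h_def, folded W_def], of "\<lambda>f. f $ m"] that
      unfolding pp fps_mult_left_const_nth fps_add_nth fps_nth_compose_X_power by simp
    then show ?thesis using p_nz by (simp add: w_def field_simps)
  qed
  have W_upto: "W \<in> series_upto m" if "\<And>k. k < m \<Longrightarrow> h $ k \<in> R" and "m > 0" for m
  proof -
    have "h oo fps_X ^ p \<in> series_upto m"
      using that p2 by (intro series_upto_compose_contracting series_power series_X)
        (auto simp: fps_X_power_nth)
    then show ?thesis
      unfolding W_def using b
      by (intro series_upto_add series_upto_sum series_upto_mult series_upto_XDs)
         (auto simp: series_iff_upto)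
  qed
  have h_nth: "h $ m = of_nat m ^ 2 * v $ m" for m
    by (simp add: h_def power2_eq_square)
  have h: "h $ m \<in> R" for m
  proof (induction m rule: less_induct)
    case (less m)
    show ?case
    proof (cases "m = 0")
      case True
      then show ?thesis using zero_closed by (simp add: h_nth)
    next
      case False
      then have "W $ m \<in> R" using W_upto[of m] less by (simp add: series_upto_def)
      moreover have "h $ m = of_nat m ^ 2 * W $ m + (if p dvd m then h $ (m div p) else 0)"
        using w[of m] False p_nz
        by (auto simp: h_nth w_def[of m, symmetric] elim!: dvdE)
           (auto simp: w_def field_simps power2_eq_square)
      moreover have "(if p dvd m then h $ (m div p) else 0) \<in> R"
        using less[of "m div p"] False p2 zero_closed by simp
      moreover have "of_nat m ^ 2 \<in> R"
        unfolding power2_eq_square by (intro mult_closed of_nat_closed)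
      ultimately show ?thesis by (simp add: add_closed mult_closed)
    qed
  qed
  show "m > 0 \<Longrightarrow> v $ m - (if p dvd m then v $ (m div p) else 0) / of_nat p ^ 2 \<in> R"
    using W_upto[of m] h w[of m] by (simp add: w_def series_upto_def)
qed

lemma yukawa_nth:
  assumes "m > 0"
  shows "yukawa F $ m = of_nat m ^ 2 * v $ m"
proof -
  have "yukawa F = 1 + fps_XD (fps_XD v)"
    using yukawa_log_eq[of F] F0 by (simp add: v_def V_def G_def)
  then show ?thesis using assms by (simp add: power2_eq_square)
qed

end


section \<open>Lambert series\<close>

lemma lambert_term_nth:
  fixes c :: "'a::field_char_0"
  assumes "r > 0"
  shows "(fps_const c * fps_X ^ r / (1 - fps_X ^ r)) $ m = (if m > 0 \<and> r dvd m then c else 0)"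
proof -
  define f where "f = Abs_fps (\<lambda>m. if m > 0 \<and> r dvd m then c else 0)"
  have unit: "(1 - fps_X ^ r :: 'a fps) $ 0 \<noteq> 0" using assms by (simp add: fps_X_power_nth)
  have "f * (1 - fps_X ^ r) = fps_const c * fps_X ^ r"
  proof (rule fps_ext)
    fix m
    have "(f * (1 - fps_X ^ r)) $ m = f $ m - (if m < r then 0 else f $ (m - r))"
      by (simp add: right_diff_distrib fps_X_power_mult_right_nth)
    also have "\<dots> = (if m = r then c else 0)"
      using assms by (auto simp: f_def dvd_imp_le dvd_minus_self)
    finally show "(f * (1 - fps_X ^ r)) $ m = (fps_const c * fps_X ^ r) $ m"
      by (simp add: fps_X_power_nth)
  qed
  then have "fps_const c * fps_X ^ r / (1 - fps_X ^ r) = f * (1 - fps_X ^ r) / (1 - fps_X ^ r)"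
    by simp
  also have "\<dots> = f" using unit by (intro nonzero_mult_div_cancel_right) (metis fps_zero_nth)
  finally show ?thesis by (simp add: f_def)
qed

lemma lambert_sums_nth:
  fixes A :: "nat \<Rightarrow> 'a::field_char_0"
  assumes "(\<lambda>r. fps_const (A (Suc r)) * fps_X ^ Suc r / (1 - fps_X ^ Suc r)) sums f" and "m > 0"
  shows "f $ m = (\<Sum>r | r dvd m. A r)"
proof -
  have "eventually (\<lambda>N. (\<Sum>r<N. fps_const (A (Suc r)) * fps_X ^ Suc r / (1 - fps_X ^ Suc r)) $ m
      = f $ m) sequentially"
    using assms(1) unfolding sums_def tendsto_fps_iff by blast
  then obtain N where N: "N \<ge> m"
    "(\<Sum>r<N. fps_const (A (Suc r)) * fps_X ^ Suc r / (1 - fps_X ^ Suc r)) $ m = f $ m"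
    unfolding eventually_sequentially by (metis nle_le)
  have "f $ m = (\<Sum>r<N. if Suc r dvd m then A (Suc r) else 0)"
    unfolding N(2)[symmetric] fps_sum_nth
    using assms(2) by (intro sum.cong refl) (simp only: lambert_term_nth zero_less_Suc simp_thms)
  also have "\<dots> = (\<Sum>r\<in>{r\<in>{..<N}. Suc r dvd m}. A (Suc r))"
    by (rule sum.inter_filter[symmetric]) simp
  also have "\<dots> = (\<Sum>r\<in>Suc ` {r\<in>{..<N}. Suc r dvd m}. A r)"
    by (simp add: sum.reindex)
  also have "Suc ` {r\<in>{..<N}. Suc r dvd m} = {r. r dvd m}"
  proof (intro equalityI subsetI)
    fix r assume "r \<in> {r. r dvd m}"
    then have r: "r dvd m" "r > 0" "r \<le> m" using assms(2) by (auto simp: dvd_imp_le dvd_pos_nat)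
    then show "r \<in> Suc ` {r\<in>{..<N}. Suc r dvd m}"
      using N(1) by (intro image_eqI[of _ _ "r - 1"]) auto
  qed auto
  finally show ?thesis .
qed

text \<open>
  Multiplying the hypothesis on \<open>v\<close> by \<open>m\<^sup>2\<close>, the sum of \<open>A\<^sub>r\<close> over the divisors \<open>r\<close> of \<open>m\<close> that
  do not divide \<open>m/p\<close> lies in \<open>m\<^sup>2 \<int>\<^sub>p\<close>.  These are the \<open>r = m/s\<close> with \<open>s\<close> prime to \<open>p\<close>, for which
  \<open>r\<^sup>2 \<int>\<^sub>p = m\<^sup>2 \<int>\<^sub>p\<close>, so by induction the term with \<open>r = m\<close> can be isolated.
\<close>

lemma lambert_coefficients_integral:
  fixes A v :: "nat \<Rightarrow> 'p::prime_card padic"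
  assumes A: "\<And>m. m > 0 \<Longrightarrow> of_nat m ^ 2 * v m = (\<Sum>r | r dvd m. A r)"
    and v: "\<And>m. m > 0 \<Longrightarrow>
      v m - (if CARD('p) dvd m then v (m div CARD('p)) else 0) / of_nat CARD('p) ^ 2 \<in> Zp"
  shows "m > 0 \<Longrightarrow> A m / of_nat m ^ 2 \<in> Zp"
proof (induction m rule: less_induct)
  case (less m)
  define p where "p = CARD('p)"
  have p: "p > 1" using prime_gt_1_nat[OF prime_card[where 'a = 'p]] by (simp add: p_def)
  define w where "w = v m - (if p dvd m then v (m div p) else 0) / of_nat p ^ 2"
  (* D - D' consists of the quotients of m by its divisors prime to p. *)
  define D where "D = {r. r dvd m}"
  define D' where "D' = (if p dvd m then {r. r dvd m div p} else {})"
  have fin: "finite D" using less.prems by (simp add: D_def)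
  have sub: "D' \<subseteq> D" by (auto simp: D_def D'_def intro: dvd_trans split: if_splits elim!: dvdE)
  have m_nz: "(of_nat m :: 'p padic) \<noteq> 0" using less.prems by simp
  have "of_nat m ^ 2 * w = (\<Sum>r\<in>D. A r) - (\<Sum>r\<in>D'. A r)"
  proof (cases "p dvd m")
    case True
    then obtain k where k: "m = p * k" by blast
    then have "k > 0" using less.prems by simp
    have "of_nat m ^ 2 * w = of_nat m ^ 2 * v m - of_nat k ^ 2 * v k"
      using p by (simp add: w_def k field_simps power2_eq_square)
    then show ?thesis
      using A[OF less.prems] A[OF \<open>k > 0\<close>] p by (simp add: D_def D'_def k)
  next
    case False
    then show ?thesis using A[OF less.prems] by (simp add: w_def D_def D'_def)
  qed
  also have "\<dots> = (\<Sum>r\<in>D - D'. A r)" using fin sub by (simp add: sum_diff)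
  also have "\<dots> = A m + (\<Sum>r\<in>D - D' - {m}. A r)"
  proof (rule sum.remove)
    show "finite (D - D')" using fin by simp
    have "\<not> m dvd m div p" if "p dvd m"
      using that less.prems p by (auto dest!: dvd_imp_le elim!: dvdE)
    then show "m \<in> D - D'" by (simp add: D_def D'_def)
  qed
  finally have "A m / of_nat m ^ 2 = w - (\<Sum>r\<in>D - D' - {m}. A r / of_nat m ^ 2)"
    using m_nz by (simp add: sum_divide_distrib[symmetric] field_simps)
  also have "\<dots> \<in> Zp"
  proof (intro Zp.diff_closed Zp.sum_closed)
    show "w \<in> Zp" using v[OF less.prems] by (simp only: w_def p_def)
    fix r assume r: "r \<in> D - D' - {m}"
    then obtain s where s: "m = r * s" by (auto simp: D_def)
    have "r > 0" "r < m" using r s less.prems by (auto simp: D_def dvd_imp_le le_neq_implies_less)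
    have "\<not> p dvd s"
    proof
      assume "p dvd s"
      then obtain k where "m = p * (r * k)" using s by (auto elim!: dvdE)
      then show False using r p by (auto simp: D'_def)
    qed
    then have "1 / of_nat s \<in> (Zp :: 'p padic set)"
      unfolding p_def by (rule inverse_of_nat_in_Zp)
    moreover have "A r / of_nat r ^ 2 \<in> Zp" using less.IH \<open>r > 0\<close> \<open>r < m\<close> by blast
    moreover have "A r / of_nat m ^ 2 =
        (A r / of_nat r ^ 2) * ((1 / of_nat s) * (1 / of_nat s))"
      by (simp add: s power2_eq_square)
    ultimately show "A r / of_nat m ^ 2 \<in> Zp" by (metis Zp.mult_closed)
  qed
  finally show ?case .
qed

theorem theorem1p6:
  fixes p n :: nat
    and a F :: "nat \<Rightarrow> 'p::prime_card padic fps"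
    and A :: "nat \<Rightarrow> 'p padic"
  assumes "p = CARD('p)" and "odd p" and "n \<ge> 3"
    and "\<forall>i<n. a i \<in> Zp_fps \<and> a i $ 0 = 0"
    and "standard_basis n a F"
    and "exp_ratio F \<in> Zp_fps"
    and "(\<lambda>r. fps_const (A (Suc r)) * fps_X ^ Suc r / (1 - fps_X ^ Suc r)) sums (yukawa F - 1)"
    and "\<exists>\<A>. frobenius_structure n a (canonical_coord F) \<A> \<and> frobenius_constant \<A> 1 = 0"
  shows "\<forall>r\<ge>1. A r / of_nat r ^ 2 \<in> Zp"
proof -
  obtain \<A> where fs: "frobenius_structure n a (canonical_coord F) \<A>"
    and const: "frobenius_constant \<A> 1 = 0"
    using assms(8) by blast
  interpret integral_frobenius F Zp n p a \<A>
  proof unfold_locales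
    show "F 0 $ 0 = 1" "F 1 $ 0 = 0" "F 2 $ 0 = 0"
      and "i < n \<Longrightarrow> diff_op n a (log_sol F i) = 0" for i
      using assms(3,5) by (auto simp: standard_basis_def)
    show "p \<ge> 2" using assms(1) prime_ge_2_nat[OF prime_card[where 'a = 'p]] by simp
    show "\<A> 1 $ 0 = 0" using const by (simp add: frobenius_constant_def)
    show "\<A> 0 $ 0 = 1"
      and "i < n \<Longrightarrow> \<A> i \<in> Zp.series"
      and "diff_op n a y = 0 \<Longrightarrow>
        diff_op n a (theta_op n \<A> (frob_log p (canonical_coord F) y)) = 0" for i y
      using fs assms(1) by (auto simp: frobenius_structure_def)
  qed (use assms in auto)
  have "A r / of_nat r ^ 2 \<in> Zp" if "r > 0" for r
  proof (rule lambert_coefficients_integral[where v = "\<lambda>m. v $ m"])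
    show "of_nat m ^ 2 * v $ m = (\<Sum>r | r dvd m. A r)" if "m > 0" for m
      using lambert_sums_nth[OF assms(7) that] yukawa_nth[OF that] that by simp
    show "v $ m - (if CARD('p) dvd m then v $ (m div CARD('p)) else 0) / of_nat CARD('p) ^ 2 \<in> Zp"
      if "m > 0" for m
      using frobenius_integrality[OF that] by (simp only: assms(1))
  qed (rule that)
  then show ?thesis by simp
qed

end
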